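(* Let $g$ be a sufficiently large natural number, let $b\in\{2,3,\dots,g-1\}$ be fixed, and let $X$ be a power of $g$. For real $Y<Z$ let $[Y,Z]^{\ast}$ denote the set of natural numbers $n$ with $Y<n\le Z$ whose base-$g$ expansion uses only digits from $\{0,1,\dots,g-1\}\setminus\{b\}$. Let $$\lambda=1-\frac{\log(\log g+1)}{\log(g-1)},$$ and let $H>0$ satisfy $|[1,H]^{\ast}|=\left(X/(\log X)^{3}\right)^{1/(2\lambda)}$. Let $\eta>0$ be a sufficiently small fixed constant and put $P=X^{1/4-\eta}$, $Q=P^{2}$. Then, as $X\to\infty$, $$\sum_{n\in[X,X+H]^{\ast}} d_2(n)=\sum_{q\le P}\int_{|\beta|<\frac{1}{qQ}}\int_X^{X+H} p^{\ast}_{2,q}(x)\,e(\beta x)\sum_{n\in[X,X+H]^{\ast}} c_q(n)\,e(-n\beta)\,dx\,d\beta+O\!\left(|[X,X+H]^{\ast}|(\log X)^{5/2}\right),$$ where $$p^{\ast}_{2,q}(x)=\frac{1}{q}\left(\log x+2\gamma-2\log q\right),\qquad c_q(n)=\sum_{\substack{1\le a\le q\\ (a,q)=1}} e\!\left(\frac{an}{q}\right).$$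
   Context: $d_2(n)$ denotes the number of positive divisors of $n$; $e(x)=e^{2\pi i x}$; $\gamma$ is the Euler–Mascheroni constant; $|A|$ denotes the cardinality of a finite set $A$. *)

theory Defs
  imports "HOL-Analysis.Analysis"
begin

text \<open>The digits in the base-\<open>g\<close> expansion of \<open>n\<close>, without leading zeros: position \<open>i\<close> occurs
  in the expansion iff \<open>g ^ i \<le> n\<close>.\<close>

definition base_digits :: "nat \<Rightarrow> nat \<Rightarrow> nat set" where
  "base_digits g n = {(n div g ^ i) mod g | i. g ^ i \<le> n}"

definition missing_digit_interval :: "nat \<Rightarrow> nat \<Rightarrow> real \<Rightarrow> real \<Rightarrow> nat set" where
  "missing_digit_interval g b Y Z =
     {n. Y < real n \<and> real n \<le> Z \<and> base_digits g n \<subseteq> {0..<g} - {b}}"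

definition d2 :: "nat \<Rightarrow> nat" where
  "d2 n = card {d. d dvd n}"

definition e :: "real \<Rightarrow> complex" where
  "e x = exp (2 * of_real pi * \<i> * of_real x)"

definition ramanujan_sum :: "nat \<Rightarrow> nat \<Rightarrow> complex" where
  "ramanujan_sum q n = (\<Sum>a | 1 \<le> a \<and> a \<le> q \<and> coprime a q. e (real a * real n / real q))"

definition p2_star :: "nat \<Rightarrow> real \<Rightarrow> real" where
  "p2_star q x = 1 / real q * (ln x + 2 * euler_mascheroni - 2 * ln (real q))"

text \<open>The exponent governing the length \<open>H\<close> of the short interval. The prescribed size
  \<open>(X / (ln X) ^ 3) powr (1 / (2 * lambda_exp g))\<close> of \<open>missing_digit_interval g b 1 H\<close> is in general
  not an integer, so the equality of the two has to be read up to rounding, that is, up to an error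
  less than \<open>1\<close>.\<close>

definition lambda_exp :: "nat \<Rightarrow> real" where
  "lambda_exp g = 1 - ln (ln (real g) + 1) / ln (real g - 1)"

definition major_arc_term :: "nat set \<Rightarrow> real \<Rightarrow> real \<Rightarrow> real \<Rightarrow> real \<Rightarrow> complex" where
  "major_arc_term A X H P Q =
     (\<Sum>q | 1 \<le> q \<and> real q \<le> P.
        integral {\<beta>. \<bar>\<beta>\<bar> < 1 / (real q * Q)} (\<lambda>\<beta>.
          integral {X..X + H} (\<lambda>x.
            of_real (p2_star q x) * e (\<beta> * x) *
              (\<Sum>n\<in>A. ramanujan_sum q n * e (- (real n * \<beta>))))))"

end

theory Submission
  imports Defs "HOL-Number_Theory.Totient" "HOL-Real_Asymp.Real_Asymp"
begin

text \<open>
  The error term exceeds both sides: the divisor sum and the major arc term are separately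
  \<open>O(|A| (ln X)\<^sup>5\<^sup>/\<^sup>2)\<close>.  Let \<open>g\<^sup>j \<le> H < g\<^sup>j\<^sup>+\<^sup>1\<close>, let \<open>F\<^sub>i\<close> be the exponential sum over the numbers
  below \<open>g\<^sup>i\<close> without the digit \<open>b\<close>, and put \<open>L = ln g + 1\<close>.  As \<open>F\<^sub>i\<close> is a product over the digit
  positions, its values at points of distinct cells of length \<open>g\<^sup>-\<^sup>m\<close> add up to at most
  \<open>(g - 1)\<^sup>i\<^sup>-\<^sup>m (g L)\<^sup>m\<close> if \<open>m \<le> i\<close>, and to at most \<open>g\<^sup>m L\<^sup>i\<close> otherwise.  Applied to the reduced
  fractions \<open>a/q\<close> with \<open>g\<^sup>s \<le> q < g\<^sup>s\<^sup>+\<^sup>1\<close>, possibly shifted a little, this gives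
  \<open>\<Sum>\<^sub>q 1/q \<Sum>\<^sub>a |F\<^sub>i(a/q - \<beta>\<^sub>q)| \<lless> (g - 1)\<^sup>i + D L\<^sup>i\<close> for denominators up to \<open>D\<close>, and hence
  a bound \<open>\<lless> |A| + D L\<^sup>j\<close> for the same double sum over \<open>A\<close>.

  The divisor sum is at most twice the number of pairs \<open>d | n\<close> with \<open>d \<le> \<surd>n\<close>; detecting \<open>d | n\<close> by
  additive characters reduces it to this estimate with \<open>D\<close> of order \<open>\<surd>X\<close>, at the cost of one factor
  \<open>ln X\<close>.  By the choice of \<open>H\<close>, \<open>\<surd>X L\<^sup>j \<le> |A| (ln X)\<^sup>3\<^sup>/\<^sup>2\<close>.  On the major arcs the inner integral is
  \<open>O(1/q ln X min(H, 1/|\<beta>|))\<close>, which costs \<open>(ln X)\<^sup>2\<close> after integration over \<open>\<beta>\<close>, and the estimate is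
  applied with \<open>D\<close> of order \<open>P\<close>, where the second term is negligible.
\<close>

section \<open>Exponential sums over sets of natural numbers\<close>

lemma e_conv_cis: "e x = cis (2 * pi * x)"
  unfolding e_def cis_conv_exp by (simp add: algebra_simps)

lemma e_add: "e (x + y) = e x * e y"
  by (simp add: e_conv_cis cis_mult distrib_left)

lemma norm_e [simp]: "norm (e x) = 1"
  by (simp add: e_conv_cis)

lemma e_of_int [simp]: "e (of_int k) = 1"
  by (simp add: e_conv_cis cis_multiple_2pi)

lemma e_of_nat [simp]: "e (of_nat k) = 1"
  using e_of_int[of "int k"] by simp

lemma e_0 [simp]: "e 0 = 1"
  using e_of_int[of 0] by simp

lemma e_power: "e x ^ n = e (real n * x)"
  by (simp add: e_def mult_ac flip: exp_of_nat_mult)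

lemma norm_one_minus_e: "norm (1 - e x) = 2 * \<bar>sin (pi * x)\<bar>"
  using dist_exp_i_1[of "2 * pi * x"]
  by (simp add: e_conv_cis cis_conv_exp norm_minus_commute)

lemma norm_sum_e_le:
  assumes "sin (pi * x) \<noteq> 0"
  shows "norm (\<Sum>d<n. e (real d * x)) \<le> 1 / \<bar>sin (pi * x)\<bar>"
proof -
  have "e x \<noteq> 1"
    using assms norm_one_minus_e[of x] by auto
  hence "(\<Sum>d<n. e (real d * x)) = (1 - e x ^ n) / (1 - e x)"
    by (simp add: sum_gp_strict flip: e_power)
  hence "norm (\<Sum>d<n. e (real d * x)) = norm (1 - e x ^ n) / (2 * \<bar>sin (pi * x)\<bar>)"
    by (simp add: norm_divide norm_one_minus_e)
  also have "norm (1 - e x ^ n) \<le> 2"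
    using norm_triangle_ineq4[of 1 "e x ^ n"] by (simp add: norm_power)
  finally show ?thesis by (simp add: divide_right_mono)
qed

lemma sin_pi_ge:
  assumes "0 \<le> x" "x \<le> 1"
  shows "pi * x * (1 - x) \<le> sin (pi * x)"
proof -
  have half: "pi * x * (1 - x) \<le> sin (pi * x)" if x: "0 \<le> x" "x \<le> 1 / 2" for x :: real
  proof -
    have "\<bar>sin (pi * x) - pi * x\<bar> \<le> (pi * x) ^ 3 / 6"
      using Maclaurin_sin_bound[of "pi * x" 3] x
      by (simp add: numeral_eq_Suc sin_coeff_def inverse_eq_divide)
    moreover have "(pi * x) ^ 3 / 6 \<le> pi * x * x"
    proof -
      have "pi ^ 2 \<le> 3.2 ^ 2"
        using pi_approx by (intro power_mono) auto
      hence "pi ^ 2 * x \<le> 12 * x"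
        using x by (intro mult_right_mono) (auto simp: power2_eq_square)
      hence "(pi * x * x) * (pi ^ 2 * x / 6) \<le> (pi * x * x) * 1"
        using x by (intro mult_left_mono) auto
      thus ?thesis by (simp add: power2_eq_square power3_eq_cube mult_ac)
    qed
    ultimately have "pi * x - sin (pi * x) \<le> pi * x * x" by linarith
    thus ?thesis by (simp add: algebra_simps)
  qed
  show ?thesis
  proof (cases "x \<le> 1 / 2")
    case True
    thus ?thesis using half assms by simp
  next
    case False
    have "sin (pi * (1 - x)) = sin (pi * x)"
      using sin_pi_minus[of "pi * x"] by (simp add: algebra_simps)
    thus ?thesis using half[of "1 - x"] False assms by (simp add: mult_ac)
  qed
qed

lemma norm_sum_e_le_inverse:
  assumes "0 < x" "x < 1"
  shows "norm (\<Sum>d<n. e (real d * x)) \<le> (1 / x + 1 / (1 - x)) / 3"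
proof -
  have pos: "0 < pi * x * (1 - x)" using assms by simp
  also have sin_ge: "pi * x * (1 - x) \<le> sin (pi * x)" using assms by (intro sin_pi_ge) auto
  finally have "norm (\<Sum>d<n. e (real d * x)) \<le> 1 / sin (pi * x)"
    using norm_sum_e_le[of x n] by simp
  also have "\<dots> \<le> 1 / (pi * x * (1 - x))"
    using pos sin_ge by (intro divide_left_mono) auto
  also have "\<dots> = (1 / x + 1 / (1 - x)) / pi"
    using assms by (simp add: field_simps)
  also have "\<dots> \<le> (1 / x + 1 / (1 - x)) / 3"
    using pi_approx assms by (intro divide_left_mono) auto
  finally show ?thesis .
qed

definition exp_sum :: "nat set \<Rightarrow> real \<Rightarrow> complex" where
  "exp_sum S x = (\<Sum>n\<in>S. e (real n * x))"

lemma exp_sum_at_0 [simp]: "exp_sum S 0 = of_nat (card S)"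
  by (simp add: exp_sum_def)

lemma norm_exp_sum_le_card: "norm (exp_sum S x) \<le> real (card S)"
  unfolding exp_sum_def by (rule order.trans[OF norm_sum]) simp

lemma exp_sum_add_of_int: "exp_sum S (x + of_int k) = exp_sum S x"
proof -
  have "e (real n * (x + of_int k)) = e (real n * x)" for n
    using e_of_int[of "int n * k"] by (simp add: distrib_left e_add)
  thus ?thesis by (simp add: exp_sum_def)
qed

lemma exp_sum_frac: "exp_sum S (frac x) = exp_sum S x"
  using exp_sum_add_of_int[of S "frac x" "\<lfloor>x\<rfloor>"] by (simp add: frac_def)

lemma exp_sum_translate: "exp_sum ((+) r ` S) x = e (real r * x) * exp_sum S x"
  by (simp add: exp_sum_def sum.reindex sum_distrib_left distrib_right e_add)

lemma norm_exp_sum_translate: "norm (exp_sum ((+) r ` S) x) = norm (exp_sum S x)"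
  by (simp add: exp_sum_translate norm_mult)

lemma exp_sum_mult_add_image:
  assumes "inj_on (\<lambda>(d, m). d * c + m) (D \<times> B)"
  shows "exp_sum ((\<lambda>(d, m). d * c + m) ` (D \<times> B)) x = exp_sum D (real c * x) * exp_sum B x"
  using assms
  by (simp add: exp_sum_def sum.reindex sum_product sum.cartesian_product case_prod_unfold
      distrib_right mult.assoc flip: e_add)

section \<open>Numbers without a given digit\<close>

lemma inj_on_mult_add: "inj_on (\<lambda>(d, m). d * c + m) (UNIV \<times> {..<c::nat})"
proof -
  have "d = (d * c + m) div c \<and> m = (d * c + m) mod c" if "m < c" for d m
    using that by simp
  thus ?thesis by (intro inj_onI, clarify) metis
qed

locale missing_digit =
  fixes g b :: nat
  assumes b_pos: "0 < b" and b_less: "b < g"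
begin

lemma g_ge_2: "2 \<le> g"
  using b_pos b_less by simp

definition avoids :: "nat \<Rightarrow> bool" where
  "avoids n \<longleftrightarrow> (\<forall>i. (n div g ^ i) mod g \<noteq> b)"

definition below :: "nat \<Rightarrow> nat set" where
  "below N = {m. m < N \<and> avoids m}"

definition digits :: "nat set" where
  "digits = {..<g} - {b}"

lemma base_digits_subset_iff: "base_digits g n \<subseteq> {0..<g} - {b} \<longleftrightarrow> avoids n"
proof -
  have "(n div g ^ i) mod g \<noteq> b" if "\<not> g ^ i \<le> n" for i
    using that b_pos by simp
  thus ?thesis
    unfolding base_digits_def avoids_def using b_less by (fastforce simp: subset_iff)
qed

lemma avoids_0 [simp]: "avoids 0"
  using b_pos by (simp add: avoids_def)

lemma avoids_iff_div: "avoids n \<longleftrightarrow> n mod g \<noteq> b \<and> avoids (n div g)"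
proof -
  have "avoids n \<longleftrightarrow> n mod g \<noteq> b \<and> (\<forall>i. (n div g ^ Suc i) mod g \<noteq> b)"
    unfolding avoids_def by (metis div_by_1 not0_implies_Suc power_0)
  thus ?thesis by (simp add: avoids_def div_mult2_eq)
qed

lemma avoids_mult_power_add:
  assumes "m < g ^ i" "d < g"
  shows "avoids (d * g ^ i + m) \<longleftrightarrow> d \<noteq> b \<and> avoids m"
  using assms(1)
proof (induction i arbitrary: m)
  case 0
  thus ?case using avoids_iff_div[of d] assms(2) by simp
next
  case (Suc i)
  have split: "d * g ^ Suc i + m = m + g * (d * g ^ i)" by simp
  have "m div g < g ^ i"
    using Suc.prems by (simp add: less_mult_imp_div_less mult.commute)
  hence "avoids (d * g ^ i + m div g) \<longleftrightarrow> d \<noteq> b \<and> avoids (m div g)"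
    by (rule Suc.IH)
  moreover have "(d * g ^ Suc i + m) div g = d * g ^ i + m div g"
    unfolding split using g_ge_2 by simp
  moreover have "(d * g ^ Suc i + m) mod g = m mod g"
    unfolding split by simp
  ultimately show ?case
    using avoids_iff_div[of m] avoids_iff_div[of "d * g ^ Suc i + m"] by auto
qed

lemma finite_below [simp]: "finite (below N)"
  by (simp add: below_def)

lemma below_0 [simp]: "below 0 = {}"
  by (simp add: below_def)

lemma below_1 [simp]: "below (Suc 0) = {0}"
  by (auto simp: below_def)

lemma below_mult_power:
  assumes "t \<le> g"
  shows "below (t * g ^ i) = (\<lambda>(d, m). d * g ^ i + m) ` (({..<t} - {b}) \<times> below (g ^ i))"
proof (intro equalityI subsetI)
  fix n assume n_mem: "n \<in> below (t * g ^ i)"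
  define d m where "d = n div g ^ i" and "m = n mod g ^ i"
  have n_eq: "n = d * g ^ i + m" by (simp only: d_def m_def div_mult_mod_eq)
  have "d < t" using n_mem by (simp add: d_def below_def less_mult_imp_div_less)
  moreover have "m < g ^ i" using g_ge_2 by (simp add: m_def)
  ultimately have "(d, m) \<in> ({..<t} - {b}) \<times> below (g ^ i)"
    using n_mem avoids_mult_power_add[of m i d] assms by (simp add: n_eq below_def)
  thus "n \<in> (\<lambda>(d, m). d * g ^ i + m) ` (({..<t} - {b}) \<times> below (g ^ i))"
    using n_eq by force
next
  fix n assume "n \<in> (\<lambda>(d, m). d * g ^ i + m) ` (({..<t} - {b}) \<times> below (g ^ i))"
  then obtain d m where decomp: "n = d * g ^ i + m" "d < t" "d \<noteq> b" "m < g ^ i" "avoids m"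
    by (auto simp: below_def)
  have "n < Suc d * g ^ i" using decomp by simp
  also have "\<dots> \<le> t * g ^ i" using decomp by (intro mult_right_mono) auto
  finally show "n \<in> below (t * g ^ i)"
    using decomp assms avoids_mult_power_add[of m i d] by (simp add: below_def)
qed

lemma below_mult_power_add:
  assumes "n \<le> g ^ i" "t < g"
  shows "below (t * g ^ i + n) =
    below (t * g ^ i) \<union> (if t = b then {} else (+) (t * g ^ i) ` below n)"
proof (rule set_eqI)
  fix m
  show "m \<in> below (t * g ^ i + n) \<longleftrightarrow>
    m \<in> below (t * g ^ i) \<union> (if t = b then {} else (+) (t * g ^ i) ` below n)"
  proof (cases "m < t * g ^ i")
    case False
    then obtain r where "m = t * g ^ i + r" by (auto simp: not_less le_iff_add)
    thus ?thesis using avoids_mult_power_add[of r i t] assms by (auto simp: below_def)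
  qed (auto simp: below_def)
qed

lemma exp_sum_below_mult_power:
  assumes "t \<le> g"
  shows "exp_sum (below (t * g ^ i)) x =
    exp_sum ({..<t} - {b}) (real g ^ i * x) * exp_sum (below (g ^ i)) x"
proof -
  have "inj_on (\<lambda>(d, m). d * g ^ i + m) (({..<t} - {b}) \<times> below (g ^ i))"
    by (rule inj_on_subset[OF inj_on_mult_add]) (auto simp: below_def)
  thus ?thesis
    by (simp add: below_mult_power[OF assms] exp_sum_mult_add_image)
qed

lemma exp_sum_below_power_Suc:
  "exp_sum (below (g ^ Suc i)) x = exp_sum digits (real g ^ i * x) * exp_sum (below (g ^ i)) x"
  using exp_sum_below_mult_power[of g i x] by (simp add: digits_def)

lemma card_digits: "card digits = g - 1"
  using b_less by (simp add: digits_def)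

lemma card_below_power: "card (below (g ^ i)) = (g - 1) ^ i"
proof (induction i)
  case (Suc i)
  have "complex_of_nat (card (below (g ^ Suc i))) = of_nat ((g - 1) * card (below (g ^ i)))"
    using exp_sum_below_power_Suc[of i 0] by (simp add: card_digits del: power_Suc)
  thus ?case using Suc.IH by (simp only: of_nat_eq_iff power_Suc)
qed simp

lemma norm_exp_sum_digits_le: "norm (exp_sum digits x) \<le> real g - 1"
  using norm_exp_sum_le_card[of digits x] b_less by (simp add: card_digits of_nat_diff)

lemma norm_exp_sum_below_power_le:
  assumes "m \<le> i"
  shows "norm (exp_sum (below (g ^ i)) x) \<le>
    (real g - 1) ^ (i - m) * norm (exp_sum (below (g ^ m)) x)"
  using assms
proof (induction i rule: dec_induct)
  case (step i)
  have "norm (exp_sum (below (g ^ Suc i)) x) =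
      norm (exp_sum digits (real g ^ i * x)) * norm (exp_sum (below (g ^ i)) x)"
    by (simp add: exp_sum_below_power_Suc norm_mult del: power_Suc)
  also have "\<dots> \<le> (real g - 1) * ((real g - 1) ^ (i - m) * norm (exp_sum (below (g ^ m)) x))"
    using b_less by (intro mult_mono norm_exp_sum_digits_le step.IH) auto
  also have "\<dots> = (real g - 1) ^ (Suc i - m) * norm (exp_sum (below (g ^ m)) x)"
    using step.hyps by (simp add: Suc_diff_le)
  finally show ?case .
qed simp

lemma norm_exp_sum_below_le:
  "N < g ^ J \<Longrightarrow> norm (exp_sum (below N) x) \<le> real g * (\<Sum>i<J. norm (exp_sum (below (g ^ i)) x))"
proof (induction J arbitrary: N)
  case 0
  thus ?case by (simp add: exp_sum_def)
next
  case (Suc J)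
  define t n where "t = N div g ^ J" and "n = N mod g ^ J"
  have N_eq: "N = t * g ^ J + n" by (simp only: t_def n_def div_mult_mod_eq)
  have n_less: "n < g ^ J" using g_ge_2 by (simp add: n_def)
  have t_less: "t < g" using Suc.prems by (simp add: t_def less_mult_imp_div_less)
  have "card ({..<t} - {b}) \<le> g"
    using t_less card_mono[of "{..<t}" "{..<t} - {b}"] by simp
  hence "norm (exp_sum ({..<t} - {b}) (real g ^ J * x)) \<le> real g"
    using norm_exp_sum_le_card[of "{..<t} - {b}" "real g ^ J * x"] by linarith
  hence head: "norm (exp_sum (below (t * g ^ J)) x) \<le> real g * norm (exp_sum (below (g ^ J)) x)"
    using t_less by (simp add: exp_sum_below_mult_power norm_mult mult_right_mono)
  have tail: "norm (exp_sum (if t = b then {} else (+) (t * g ^ J) ` below n) x) \<le>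
      norm (exp_sum (below n) x)"
    by (auto simp: norm_exp_sum_translate) (simp add: exp_sum_def)
  have "exp_sum (below N) x =
      exp_sum (below (t * g ^ J)) x + exp_sum (if t = b then {} else (+) (t * g ^ J) ` below n) x"
    unfolding N_eq below_mult_power_add[OF less_imp_le[OF n_less] t_less] unfolding exp_sum_def
    by (rule sum.union_disjoint) (auto simp: below_def)
  hence "norm (exp_sum (below N) x) \<le>
      real g * norm (exp_sum (below (g ^ J)) x) + norm (exp_sum (below n) x)"
    using head tail norm_triangle_mono by metis
  also have "norm (exp_sum (below n) x) \<le> real g * (\<Sum>i<J. norm (exp_sum (below (g ^ i)) x))"
    using n_less by (rule Suc.IH)
  finally show ?case by (simp add: algebra_simps)
qed

end

section \<open>Exponential sums at points of distinct cells\<close>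

lemma sum_mod_div:
  fixes f :: "nat \<Rightarrow> nat \<Rightarrow> 'a::comm_monoid_add"
  shows "(\<Sum>t<n * k. f (t mod k) (t div k)) = (\<Sum>s<n. \<Sum>j<k. f j s)"
proof -
  have "(\<Sum>t\<in>{s * k..<s * k + k}. f (t mod k) (t div k)) = (\<Sum>j<k. f j s)" for s
    by (rule sum.reindex_bij_witness[of _ "\<lambda>j. s * k + j" "\<lambda>t. t mod k"])
       (auto simp: mod_less_divisor modulo_nat_def div_nat_eqI mult.commute)
  thus ?thesis by (simp flip: sum.nat_group)
qed

lemma sum_inj_on_le:
  fixes h :: "'b \<Rightarrow> real"
  assumes "inj_on f I" "f ` I \<subseteq> S" "finite S" "\<And>t. t \<in> S \<Longrightarrow> 0 \<le> h t"
  shows "(\<Sum>x\<in>I. h (f x)) \<le> sum h S"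
  using sum_mono2[of S "f ` I" h] assms by (auto simp: sum.reindex)

lemma harm_le_ln: "n > 0 \<Longrightarrow> harm n \<le> 1 + ln (real n)"
  using euler_mascheroni_sequence_decreasing[of 1 n] by (simp add: harm_expand)

context missing_digit
begin

text \<open>Bounding the digit sum by its supremum over each cell \<open>[j/g, (j+1)/g)\<close>, rather than at
  single points, makes the product over all digit positions independent of where a point lies
  inside its cell, so that no integral large sieve is needed.  The sum over the cells has leading
  term \<open>(2/3) g ln g\<close>; that the factor is below \<open>1\<close> is what large \<open>g\<close> is needed for.\<close>

definition cell_bound :: "nat \<Rightarrow> real" where
  "cell_bound j = (if j = 0 \<or> Suc j = g then real g
     else 1 + (real g / real j + real g / real (g - 1 - j)) / 3)"

lemma cell_bound_nonneg: "0 \<le> cell_bound j"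
  by (auto simp: cell_bound_def intro!: add_nonneg_nonneg)

lemma norm_exp_sum_digits_le_cell_bound:
  assumes "j < g" "real j / real g \<le> x" "x < real (Suc j) / real g"
  shows "norm (exp_sum digits x) \<le> cell_bound j"
proof (cases "j = 0 \<or> Suc j = g")
  case True
  thus ?thesis using norm_exp_sum_digits_le[of x] by (auto simp: cell_bound_def)
next
  case False
  hence j_range: "0 < j" "Suc j < g" using assms(1) by auto
  have g_pos: "0 < real g" using g_ge_2 by simp
  have "0 < real j / real g" "real (Suc j) / real g \<le> 1" using j_range by auto
  hence x_range: "0 < x" "x < 1" using assms by linarith+
  have "exp_sum digits x = (\<Sum>d<g. e (real d * x)) - e (real b * x)"
    using b_less by (simp add: exp_sum_def digits_def sum_diff1)
  hence "norm (exp_sum digits x) \<le> norm (\<Sum>d<g. e (real d * x)) + 1"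
    using norm_triangle_ineq4[of "\<Sum>d<g. e (real d * x)" "e (real b * x)"] by simp
  also have "norm (\<Sum>d<g. e (real d * x)) \<le> (1 / x + 1 / (1 - x)) / 3"
    using x_range by (rule norm_sum_e_le_inverse)
  also have "1 / x \<le> real g / real j"
    using assms(2) x_range j_range g_pos by (simp add: field_simps)
  also have "1 / (1 - x) \<le> real g / real (g - 1 - j)"
    using assms(3) x_range j_range g_pos by (simp add: field_simps of_nat_diff)
  finally show ?thesis using False by (simp add: cell_bound_def)
qed

lemma sum_cell_bound_le:
  assumes "8 \<le> ln (real g)"
  shows "(\<Sum>j<g. cell_bound j) \<le> real g * (ln (real g) + 1)"
proof -
  obtain h where g_eq: "g = Suc (Suc h)"
    using g_ge_2 by (metis add_2_eq_Suc le_Suc_ex)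
  have h_pos: "0 < h" using assms g_eq by (cases h) (use ln_2_less_1 in auto)
  have harm_up: "(\<Sum>j<h. real g / real (Suc j)) = real g * harm h"
    unfolding harm_altdef by (simp add: sum_distrib_left divide_inverse)
  have harm_down: "(\<Sum>j<h. real g / real (h - j)) = real g * harm h"
    using sum.nat_diff_reindex[of "\<lambda>j. real g / real (Suc j)" h] harm_up
    by (simp add: Suc_diff_Suc)
  have "harm h \<le> 1 + ln (real h)" using h_pos by (rule harm_le_ln)
  also have "ln (real h) \<le> ln (real g)" using g_eq h_pos by simp
  finally have harm_le: "harm h \<le> 1 + ln (real g)" by simp
  have "(\<Sum>j<h. cell_bound (Suc j)) =
      (\<Sum>j<h. 1 + (real g / real (Suc j) + real g / real (h - j)) / 3)"
    unfolding cell_bound_def using g_eq by (intro sum.cong) auto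
  also have "\<dots> = real h + 2 / 3 * real g * harm h"
    by (simp only: sum.distrib sum_divide_distrib [symmetric] harm_up harm_down) simp
  also have "\<dots> \<le> real h + 2 / 3 * real g * (1 + ln (real g))"
    using harm_le by (intro add_left_mono mult_left_mono) auto
  finally have inner: "(\<Sum>j<h. cell_bound (Suc j)) \<le> real h + 2 / 3 * real g * (1 + ln (real g))" .
  have "(\<Sum>j<Suc (Suc h). cell_bound j) =
      cell_bound 0 + (\<Sum>j<h. cell_bound (Suc j)) + cell_bound (Suc h)"
    by (subst sum.lessThan_Suc_shift) simp
  also have "cell_bound 0 = real g" by (simp add: cell_bound_def)
  also have "cell_bound (Suc h) = real g" unfolding cell_bound_def using g_eq by simp
  also have "real g + (\<Sum>j<h. cell_bound (Suc j)) + real g \<le> real g * (11 / 3 + 2 / 3 * ln (real g))"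
    using inner g_eq by (simp add: field_simps)
  also have "\<dots> \<le> real g * (ln (real g) + 1)"
    using assms by (intro mult_left_mono) auto
  finally show ?thesis by (simp add: g_eq)
qed

definition cell :: "nat \<Rightarrow> real \<Rightarrow> nat" where
  "cell i x = nat \<lfloor>real g ^ i * frac x\<rfloor>"

lemma cell_less: "cell i x < g ^ i"
proof -
  have "real g ^ i * frac x < real g ^ i * 1"
    using g_ge_2 by (intro mult_strict_left_mono frac_lt_1) auto
  hence "\<lfloor>real g ^ i * frac x\<rfloor> < int (g ^ i)" by (simp add: floor_less_iff)
  thus ?thesis by (simp add: cell_def nat_less_iff)
qed

lemma cell_bounds: "real (cell i x) \<le> real g ^ i * frac x"
  "real g ^ i * frac x < real (cell i x) + 1"
  by (simp_all add: cell_def)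

lemma cell_add_div: "cell (i + l) x div g ^ l = cell i x"
proof -
  have "\<lfloor>real g ^ i * frac x\<rfloor> = \<lfloor>(real g ^ (i + l) * frac x) / real_of_int (int (g ^ l))\<rfloor>"
    using g_ge_2 by (simp add: power_add)
  also have "\<dots> = \<lfloor>real g ^ (i + l) * frac x\<rfloor> div int (g ^ l)"
    by (rule floor_divide_real_eq_div) simp
  finally show ?thesis
    by (simp add: cell_def nat_div_distrib nat_power_eq)
qed

primrec cell_prod :: "nat \<Rightarrow> nat \<Rightarrow> real" where
  "cell_prod 0 t = 1"
| "cell_prod (Suc i) t = cell_bound (t mod g) * cell_prod i (t div g)"

lemma cell_prod_nonneg: "0 \<le> cell_prod i t"
  by (induction i arbitrary: t) (auto intro: mult_nonneg_nonneg cell_bound_nonneg)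

lemma norm_exp_sum_below_le_cell_prod:
  "norm (exp_sum (below (g ^ i)) x) \<le> cell_prod i (cell i x)"
proof (induction i)
  case (Suc i)
  have g_pos: "0 < real g" using g_ge_2 by simp
  define t y where "t = cell (Suc i) x" and "y = real g ^ i * frac x"
  have t_div: "t div g = cell i x"
    using cell_add_div[of i 1 x] by (simp add: t_def)
  have t_bounds: "real t \<le> real g * y" "real g * y < real t + 1"
    using cell_bounds[of "Suc i" x] by (simp_all add: t_def y_def mult.assoc)
  have t_eq: "real t = real g * real (t div g) + real (t mod g)"
    by (metis mult_div_mod_eq of_nat_add of_nat_mult)
  have "norm (exp_sum digits (y - real (t div g))) \<le> cell_bound (t mod g)"
  proof (rule norm_exp_sum_digits_le_cell_bound)
    show "t mod g < g" using g_ge_2 by simp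
    show "real (t mod g) / real g \<le> y - real (t div g)"
      using t_bounds(1) t_eq g_pos by (simp add: field_simps)
    show "y - real (t div g) < real (Suc (t mod g)) / real g"
      using t_bounds(2) t_eq g_pos by (simp add: field_simps)
  qed
  moreover have "exp_sum digits (y - real (t div g)) = exp_sum digits y"
    using exp_sum_add_of_int[of digits y "- int (t div g)"] by simp
  moreover have "exp_sum (below (g ^ Suc i)) x = exp_sum digits y * exp_sum (below (g ^ i)) x"
    using exp_sum_below_power_Suc[of i "frac x"] by (simp add: exp_sum_frac y_def)
  ultimately have "norm (exp_sum (below (g ^ Suc i)) x) \<le>
      cell_bound (t mod g) * cell_prod i (t div g)"
    unfolding t_div using Suc.IH by (simp add: norm_mult cell_bound_nonneg mult_mono del: power_Suc)
  thus ?case by (simp add: t_def)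
qed (use norm_exp_sum_le_card[of "{0}"] in simp)

lemma sum_cell_prod: "(\<Sum>t<g ^ i. cell_prod i t) = (\<Sum>j<g. cell_bound j) ^ i"
proof (induction i)
  case (Suc i)
  have "(\<Sum>t<g ^ i * g. cell_prod (Suc i) t) = (\<Sum>s<g ^ i. \<Sum>j<g. cell_bound j * cell_prod i s)"
    unfolding cell_prod.simps by (rule sum_mod_div)
  also have "\<dots> = (\<Sum>j<g. cell_bound j) * (\<Sum>s<g ^ i. cell_prod i s)"
    by (simp only: sum_distrib_right [symmetric] sum_distrib_left [symmetric])
  finally show ?case using Suc.IH by (simp add: mult.commute)
qed simp

lemma sum_cell_prod_div:
  "(\<Sum>t<g ^ (i + l). cell_prod i (t div g ^ l)) = real g ^ l * (\<Sum>j<g. cell_bound j) ^ i"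
proof -
  have "(\<Sum>t<g ^ i * g ^ l. cell_prod i (t div g ^ l)) = (\<Sum>s<g ^ i. \<Sum>j<g ^ l. cell_prod i s)"
    by (rule sum_mod_div)
  also have "\<dots> = real g ^ l * (\<Sum>s<g ^ i. cell_prod i s)"
    by (simp add: sum_distrib_left)
  finally show ?thesis by (simp only: power_add sum_cell_prod)
qed

lemma sum_norm_exp_sum_distinct_cells_le:
  assumes "inj_on (\<lambda>x. cell (i + l) (\<alpha> x)) I"
  shows "(\<Sum>x\<in>I. norm (exp_sum (below (g ^ i)) (\<alpha> x))) \<le> real g ^ l * (\<Sum>j<g. cell_bound j) ^ i"
proof -
  have "(\<Sum>x\<in>I. norm (exp_sum (below (g ^ i)) (\<alpha> x))) \<le>
      (\<Sum>x\<in>I. cell_prod i (cell (i + l) (\<alpha> x) div g ^ l))"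
    unfolding cell_add_div by (intro sum_mono norm_exp_sum_below_le_cell_prod)
  also have "\<dots> \<le> (\<Sum>t<g ^ (i + l). cell_prod i (t div g ^ l))"
    using assms cell_less
    by (intro sum_inj_on_le[of _ _ _ "\<lambda>t. cell_prod i (t div g ^ l)"])
       (auto intro: cell_prod_nonneg)
  finally show ?thesis by (simp only: sum_cell_prod_div)
qed

end

section \<open>Reduced fractions\<close>

lemma reduced_fraction_eq_mod_1:
  assumes "a \<in> totatives q" "a' \<in> totatives q'"
    and eq: "int a * int q' - int a' * int q = z * int q * int q'"
  shows "q = q' \<and> a = a'"
proof -
  have coprime: "coprime (int a) (int q)" "coprime (int a') (int q')"
    using assms by (auto simp: in_totatives_iff)
  have range: "0 < a" "a \<le> q" "0 < a'" "a' \<le> q'"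
    using assms by (auto simp: in_totatives_iff)
  have "int a * int q' = int q * (int a' + z * int q')"
    and "int a' * int q = int q' * (int a - z * int q)"
    using eq by (simp_all add: algebra_simps)
  hence "int q dvd int q'" "int q' dvd int q"
    using coprime by (metis coprime_commute coprime_dvd_mult_right_iff dvd_triv_left)+
  hence q_eq: "q = q'" by (simp add: dvd_antisym)
  have "int q * int a = int q * (int a' + z * int q)"
    using eq q_eq by (simp add: algebra_simps)
  hence a_eq: "int a = int a' + z * int q" using range by simp
  hence "\<bar>z * int q\<bar> < int q" using q_eq range by linarith
  hence "z = 0" using range by (simp add: abs_mult)
  thus ?thesis using q_eq a_eq by simp
qed

lemma reduced_fraction_eq_if_close_mod_1:
  fixes \<beta> \<beta>' :: real and z :: int
  assumes "a \<in> totatives q" "a' \<in> totatives q'"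
    and close: "real q * real q' *
      (\<bar>(real a / real q - \<beta>) - (real a' / real q' - \<beta>') - of_int z\<bar> + \<bar>\<beta>\<bar> + \<bar>\<beta>'\<bar>) < 1"
  shows "q = q' \<and> a = a'"
proof (rule reduced_fraction_eq_mod_1[OF assms(1,2)])
  define D where "D = int a * int q' - int a' * int q - z * int q * int q'"
  define \<delta> where "\<delta> = (real a / real q - \<beta>) - (real a' / real q' - \<beta>') - of_int z"
  have q_pos: "0 < real q" "0 < real q'" using assms(1,2) by (auto simp: in_totatives_iff)
  hence "of_int D = real q * real q' * (\<delta> + \<beta> - \<beta>')"
    by (simp add: D_def \<delta>_def field_simps)
  hence "\<bar>real_of_int D\<bar> = real q * real q' * \<bar>\<delta> + \<beta> - \<beta>'\<bar>"
    by (simp add: abs_mult)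
  also have "\<dots> \<le> real q * real q' * (\<bar>\<delta>\<bar> + \<bar>\<beta>\<bar> + \<bar>\<beta>'\<bar>)"
    using q_pos by (intro mult_left_mono) auto
  finally have "D = 0" using close by (simp add: \<delta>_def)
  thus "int a * int q' - int a' * int q = z * int q * int q'" by (simp add: D_def)
qed

context missing_digit
begin

lemma cell_eq_imp_close_mod_1:
  assumes "cell m x = cell m y"
  shows "\<bar>x - y - of_int (\<lfloor>x\<rfloor> - \<lfloor>y\<rfloor>)\<bar> < 1 / real g ^ m"
proof -
  have "\<bar>real g ^ m * frac x - real g ^ m * frac y\<bar> < 1"
    using cell_bounds[of m x] cell_bounds[of m y] assms by linarith
  hence "real g ^ m * \<bar>frac x - frac y\<bar> < 1"
    by (simp add: abs_mult flip: right_diff_distrib)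
  moreover have "frac x - frac y = x - y - of_int (\<lfloor>x\<rfloor> - \<lfloor>y\<rfloor>)"
    by (simp add: frac_def)
  ultimately show ?thesis using g_ge_2 by (simp add: field_simps)
qed

lemma reduced_fractions_distinct_cells:
  assumes \<beta>: "\<And>q. q \<in> {g ^ s..<g ^ Suc s} \<Longrightarrow> \<bar>\<beta> q\<bar> \<le> 1 / (4 * real g * real q ^ 2)"
  shows "inj_on (\<lambda>(q, a). cell (2 * s + 3) (real a / real q - \<beta> q))
    (SIGMA q:{g ^ s..<g ^ Suc s}. totatives q)"
proof (rule inj_onI, clarify)
  fix q a q' a'
  assume q_mem: "q \<in> {g ^ s..<g ^ Suc s}" "q' \<in> {g ^ s..<g ^ Suc s}"
    and a_mem: "a \<in> totatives q" "a' \<in> totatives q'"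
    and same_cell: "cell (2 * s + 3) (real a / real q - \<beta> q) =
      cell (2 * s + 3) (real a' / real q' - \<beta> q')"
  have pos: "0 < real q" "0 < real q'" using a_mem by (auto simp: in_totatives_iff)
  have shift: "real q * real q' * \<bar>\<beta> q\<bar> \<le> 1 / 4"
    if "q \<in> {g ^ s..<g ^ Suc s}" "q' \<in> {g ^ s..<g ^ Suc s}" "0 < real q" for q q'
  proof -
    have "q' \<le> g * g ^ s" using that by simp
    also have "\<dots> \<le> g * q" using that by (intro mult_left_mono) auto
    finally have "real q' \<le> real g * real q" by (simp flip: of_nat_mult)
    hence "real q * real q' * \<bar>\<beta> q\<bar> \<le> real q * (real g * real q) * (1 / (4 * real g * real q ^ 2))"
      using \<beta>[OF that(1)] by (intro mult_mono) auto
    also have "\<dots> = 1 / 4" using that g_ge_2 by (simp add: power2_eq_square)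
    finally show ?thesis .
  qed
  define x y where "x = real a / real q - \<beta> q" and "y = real a' / real q' - \<beta> q'"
  have "real q * real q' * \<bar>x - y - of_int (\<lfloor>x\<rfloor> - \<lfloor>y\<rfloor>)\<bar> <
      real q * real q' * (1 / real g ^ (2 * s + 3))"
    using cell_eq_imp_close_mod_1[of "2 * s + 3" x y] same_cell pos
    by (intro mult_strict_left_mono) (auto simp: x_def y_def)
  also have "\<dots> \<le> (real g ^ Suc s * real g ^ Suc s) * (1 / real g ^ (2 * s + 3))"
    using q_mem by (intro mult_right_mono mult_mono) (auto simp flip: of_nat_power of_nat_mult)
  also have "\<dots> = 1 / real g"
    using g_ge_2
    by (simp add: power_add power_mult power2_eq_square power3_eq_cube power_mult_distrib)
  also have "\<dots> \<le> 1 / 2" using g_ge_2 by simp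
  finally show "q = q' \<and> a = a'"
    using shift[OF q_mem pos(1)] shift[OF q_mem(2,1) pos(2)]
    by (intro reduced_fraction_eq_if_close_mod_1[OF a_mem, where \<beta> = "\<beta> q" and \<beta>' = "\<beta> q'"
          and z = "\<lfloor>x\<rfloor> - \<lfloor>y\<rfloor>"])
       (simp add: distrib_left mult.commute[of "real q'"] flip: x_def y_def)
qed

end

definition fraction_mean :: "nat set \<Rightarrow> nat \<Rightarrow> real \<Rightarrow> real" where
  "fraction_mean S q \<beta> = (\<Sum>a\<in>totatives q. norm (exp_sum S (real a / real q - \<beta>))) / real q"

lemma fraction_mean_nonneg: "0 \<le> fraction_mean S q \<beta>"
  by (simp add: fraction_mean_def sum_nonneg)

lemma fraction_mean_translate: "fraction_mean ((+) r ` S) q \<beta> = fraction_mean S q \<beta>"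
  by (simp add: fraction_mean_def norm_exp_sum_translate)

lemma inverse_mult_square_le:
  fixes c q P :: real
  assumes "0 < c" "c \<le> P" "0 < q" "q \<le> P"
  shows "1 / (q * P ^ 2) \<le> 1 / (c * q ^ 2)"
proof -
  have "q * (c * q) \<le> q * (P * P)" using assms by (intro mult_left_mono mult_mono) auto
  hence "c * q ^ 2 \<le> q * P ^ 2" by (simp add: power2_eq_square mult_ac)
  thus ?thesis using assms by (intro divide_left_mono mult_pos_pos) auto
qed

lemma sum_power_le:
  fixes x :: real
  assumes "2 \<le> x"
  shows "(\<Sum>i<n. x ^ i) \<le> x ^ n"
proof (induction n)
  case (Suc n)
  have "2 * x ^ n \<le> x * x ^ n" using assms by (intro mult_right_mono) auto
  thus ?case using Suc by simp
qed simp

lemma sum_atLeastLessThan_power: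
  fixes w :: "nat \<Rightarrow> 'a::comm_monoid_add"
  assumes "1 \<le> g"
  shows "(\<Sum>q\<in>{1..<g ^ K}. w q) = (\<Sum>s<K. \<Sum>q\<in>{g ^ s..<g ^ Suc s}. w q)"
proof (induction K)
  case (Suc K)
  have "(\<Sum>q\<in>{1..<g ^ Suc K}. w q) = (\<Sum>q\<in>{1..<g ^ K}. w q) + (\<Sum>q\<in>{g ^ K..<g ^ Suc K}. w q)"
    using assms by (intro sum.atLeastLessThan_concat [symmetric]) auto
  thus ?case using Suc by simp
qed simp

locale large_base = missing_digit +
  assumes ln_base_ge: "8 \<le> ln (real g)"
    and ratio_le: "2 * (real g * (ln (real g) + 1) / (real g - 1)) ^ 2 \<le> real g"
    and lambda_ge: "2 / 3 \<le> lambda_exp g"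
begin

definition L :: real where
  "L = ln (real g) + 1"

definition \<rho> :: real where
  "\<rho> = real g * L / (real g - 1)"

lemma L_ge: "9 \<le> L"
  using ln_base_ge by (simp add: L_def)

lemma g_ge: "9 \<le> real g"
  using ln_base_ge ln_le_minus_one[of "real g"] b_less by simp

lemma \<rho>_nonneg: "0 \<le> \<rho>"
  using g_ge L_ge by (simp add: \<rho>_def)

lemma \<rho>_squared_le: "2 * \<rho> ^ 2 \<le> real g"
  using ratio_le by (simp add: \<rho>_def L_def)

lemma sum_norm_exp_sum_fine_le:
  assumes "i \<le> m" "inj_on (\<lambda>x. cell m (\<alpha> x)) I"
  shows "(\<Sum>x\<in>I. norm (exp_sum (below (g ^ i)) (\<alpha> x))) \<le> real g ^ m * L ^ i"
proof -
  have "(\<Sum>x\<in>I. norm (exp_sum (below (g ^ i)) (\<alpha> x))) \<le>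
      real g ^ (m - i) * (\<Sum>j<g. cell_bound j) ^ i"
    using assms by (intro sum_norm_exp_sum_distinct_cells_le) simp
  also have "\<dots> \<le> real g ^ (m - i) * (real g * L) ^ i"
    using sum_cell_bound_le[OF ln_base_ge]
    by (intro mult_left_mono power_mono sum_nonneg cell_bound_nonneg) (auto simp: L_def)
  also have "\<dots> = real g ^ m * L ^ i"
    using assms(1) by (simp add: power_mult_distrib flip: power_add)
  finally show ?thesis .
qed

lemma sum_norm_exp_sum_coarse_le:
  assumes "m \<le> i" "inj_on (\<lambda>x. cell m (\<alpha> x)) I"
  shows "(\<Sum>x\<in>I. norm (exp_sum (below (g ^ i)) (\<alpha> x))) \<le> (real g - 1) ^ i * \<rho> ^ m"
proof -
  have "(\<Sum>x\<in>I. norm (exp_sum (below (g ^ i)) (\<alpha> x))) \<le>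
      (real g - 1) ^ (i - m) * (\<Sum>x\<in>I. norm (exp_sum (below (g ^ m)) (\<alpha> x)))"
    unfolding sum_distrib_left by (intro sum_mono norm_exp_sum_below_power_le assms(1))
  also have "\<dots> \<le> (real g - 1) ^ (i - m) * (real g ^ m * L ^ m)"
    using g_ge assms(2) by (intro mult_left_mono sum_norm_exp_sum_fine_le) auto
  also have "\<dots> = (real g - 1) ^ i * \<rho> ^ m"
    using assms(1) g_ge by (simp add: \<rho>_def power_divide power_diff power_mult_distrib)
  finally show ?thesis .
qed

lemma sum_norm_exp_sum_reduced_fractions_le:
  assumes \<beta>: "\<And>q. q \<in> {g ^ s..<g ^ Suc s} \<Longrightarrow> \<bar>\<beta> q\<bar> \<le> 1 / (4 * real g * real q ^ 2)"
  shows "(\<Sum>q\<in>{g ^ s..<g ^ Suc s}. \<Sum>a\<in>totatives q.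
      norm (exp_sum (below (g ^ i)) (real a / real q - \<beta> q))) \<le>
    real g ^ s * ((real g - 1) ^ i * \<rho> ^ 3 * (1 / 2) ^ s + real g ^ 3 * L ^ i * real g ^ s)"
    (is "?lhs \<le> real g ^ s * (?coarse + ?fine)")
proof -
  define m where "m = 2 * s + 3"
  define I where "I = (SIGMA q:{g ^ s..<g ^ Suc s}. totatives q)"
  define \<alpha> where "\<alpha> = (\<lambda>(q, a). real a / real q - \<beta> q)"
  have inj: "inj_on (\<lambda>x. cell m (\<alpha> x)) I"
    using reduced_fractions_distinct_cells[OF \<beta>] by (simp add: m_def I_def \<alpha>_def case_prod_unfold)
  have nonneg: "0 \<le> real g ^ s * ?coarse" "0 \<le> real g ^ s * ?fine"
    using g_ge L_ge \<rho>_nonneg by simp_all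
  have "?lhs = (\<Sum>x\<in>I. norm (exp_sum (below (g ^ i)) (\<alpha> x)))"
    by (simp add: I_def \<alpha>_def sum.Sigma case_prod_unfold)
  also have "\<dots> \<le> real g ^ s * ?coarse + real g ^ s * ?fine"
  proof (cases "m \<le> i")
    case True
    have "(\<Sum>x\<in>I. norm (exp_sum (below (g ^ i)) (\<alpha> x))) \<le> (real g - 1) ^ i * \<rho> ^ m"
      using True inj by (rule sum_norm_exp_sum_coarse_le)
    also have "\<dots> = (real g - 1) ^ i * \<rho> ^ 3 * (\<rho> ^ 2) ^ s"
      by (simp add: m_def power_add power_mult)
    also have "\<dots> \<le> (real g - 1) ^ i * \<rho> ^ 3 * (real g * (1 / 2)) ^ s"
      using \<rho>_nonneg \<rho>_squared_le g_ge by (intro mult_left_mono power_mono) auto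
    also have "\<dots> = real g ^ s * ?coarse"
      by (simp only: power_mult_distrib mult_ac)
    finally show ?thesis using nonneg(2) by linarith
  next
    case False
    have "(\<Sum>x\<in>I. norm (exp_sum (below (g ^ i)) (\<alpha> x))) \<le> real g ^ m * L ^ i"
      using False inj by (intro sum_norm_exp_sum_fine_le) auto
    also have "\<dots> = real g ^ s * ?fine"
      unfolding m_def mult_2 power_add by (simp only: mult_ac)
    finally show ?thesis using nonneg(1) by linarith
  qed
  finally show ?thesis by (simp only: distrib_left)
qed

lemma sum_fraction_mean_block_le:
  assumes \<beta>: "\<And>q. q \<in> {g ^ s..<g ^ Suc s} \<Longrightarrow> \<bar>\<beta> q\<bar> \<le> 1 / (4 * real g * real q ^ 2)"
  shows "(\<Sum>q\<in>{g ^ s..<g ^ Suc s}. fraction_mean (below (g ^ i)) q (\<beta> q)) \<le>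
    (real g - 1) ^ i * \<rho> ^ 3 * (1 / 2) ^ s + real g ^ 3 * L ^ i * real g ^ s"
proof -
  have g_power: "0 < real g ^ s" using g_ge by simp
  have "(\<Sum>q\<in>{g ^ s..<g ^ Suc s}. fraction_mean (below (g ^ i)) q (\<beta> q)) \<le>
      (\<Sum>q\<in>{g ^ s..<g ^ Suc s}. (\<Sum>a\<in>totatives q.
        norm (exp_sum (below (g ^ i)) (real a / real q - \<beta> q))) / real g ^ s)"
    unfolding fraction_mean_def
  proof (intro sum_mono divide_left_mono sum_nonneg mult_pos_pos norm_ge_zero g_power)
    fix q assume "q \<in> {g ^ s..<g ^ Suc s}"
    thus "real g ^ s \<le> real q" by (simp flip: of_nat_power)
    thus "0 < real q" using g_power by linarith
  qed
  also have "\<dots> \<le> (real g - 1) ^ i * \<rho> ^ 3 * (1 / 2) ^ s + real g ^ 3 * L ^ i * real g ^ s"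
    using sum_norm_exp_sum_reduced_fractions_le[OF \<beta>] g_power
    by (simp add: pos_divide_le_eq mult.commute flip: sum_divide_distrib)
  finally show ?thesis .
qed

definition C\<^sub>F :: real where
  "C\<^sub>F = 2 * \<rho> ^ 3 + real g ^ 4"

lemma C\<^sub>F_nonneg: "0 \<le> C\<^sub>F"
  using \<rho>_nonneg by (simp add: C\<^sub>F_def)

lemma sum_fraction_mean_below_power_le:
  assumes \<beta>: "\<And>q. q \<in> {1..<g ^ K} \<Longrightarrow> \<bar>\<beta> q\<bar> \<le> 1 / (4 * real g * real q ^ 2)"
  shows "(\<Sum>q\<in>{1..<g ^ K}. fraction_mean (below (g ^ i)) q (\<beta> q)) \<le>
    2 * \<rho> ^ 3 * (real g - 1) ^ i + real g ^ 3 * (real g ^ K * L ^ i)"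
proof -
  have block: "{g ^ s..<g ^ Suc s} \<subseteq> {1..<g ^ K}" if "s < K" for s
  proof -
    have "g ^ Suc s \<le> g ^ K" using that g_ge by (intro power_increasing) auto
    moreover have "1 \<le> g ^ s" using g_ge by simp
    ultimately show ?thesis by auto
  qed
  have "(\<Sum>q\<in>{1..<g ^ K}. fraction_mean (below (g ^ i)) q (\<beta> q)) =
      (\<Sum>s<K. \<Sum>q\<in>{g ^ s..<g ^ Suc s}. fraction_mean (below (g ^ i)) q (\<beta> q))"
    using g_ge by (intro sum_atLeastLessThan_power) simp
  also have "\<dots> \<le> (\<Sum>s<K. (real g - 1) ^ i * \<rho> ^ 3 * (1 / 2) ^ s + real g ^ 3 * L ^ i * real g ^ s)"
    by (intro sum_mono sum_fraction_mean_block_le \<beta>, rule subsetD[OF block]) auto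
  also have "\<dots> = (real g - 1) ^ i * \<rho> ^ 3 * (\<Sum>s<K. (1 / 2) ^ s) +
      real g ^ 3 * L ^ i * (\<Sum>s<K. real g ^ s)"
    by (simp only: sum.distrib sum_distrib_left)
  also have "\<dots> \<le> (real g - 1) ^ i * \<rho> ^ 3 * 2 + real g ^ 3 * L ^ i * real g ^ K"
  proof (intro add_mono mult_left_mono)
    show "(\<Sum>s<K. (1 / 2) ^ s) \<le> (2 :: real)" by (simp add: sum_gp_strict)
    show "(\<Sum>s<K. real g ^ s) \<le> real g ^ K" using g_ge by (intro sum_power_le) simp
  qed (use g_ge L_ge \<rho>_nonneg in auto)
  finally show ?thesis by (simp add: mult_ac)
qed

lemma sum_fraction_mean_below_le:
  assumes "1 \<le> D" and \<beta>: "\<And>q. q \<in> {1..D} \<Longrightarrow> \<bar>\<beta> q\<bar> \<le> 1 / (4 * real g * real q ^ 2)"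
  shows "(\<Sum>q=1..D. fraction_mean (below (g ^ i)) q (\<beta> q)) \<le>
    C\<^sub>F * ((real g - 1) ^ i + real D * L ^ i)"
proof -
  obtain s where s_bounds: "g ^ s \<le> D" "D < g ^ Suc s"
    using ex_power_ivl1[of g D] g_ge_2 assms(1) by auto
  have "real g ^ s \<le> real D"
    using s_bounds(1) by (simp flip: of_nat_power)
  hence power_le: "real g ^ Suc s \<le> real g * real D"
    by (simp add: mult_left_mono)
  define \<beta>' where "\<beta>' = (\<lambda>q. if q \<le> D then \<beta> q else 0)"
  have "(\<Sum>q=1..D. fraction_mean (below (g ^ i)) q (\<beta> q)) =
      (\<Sum>q=1..D. fraction_mean (below (g ^ i)) q (\<beta>' q))"
    by (simp add: \<beta>'_def)
  also have "\<dots> \<le> (\<Sum>q\<in>{1..<g ^ Suc s}. fraction_mean (below (g ^ i)) q (\<beta>' q))"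
    using s_bounds(2) by (intro sum_mono2) (auto simp: fraction_mean_nonneg)
  also have "\<dots> \<le> 2 * \<rho> ^ 3 * (real g - 1) ^ i + real g ^ 3 * (real g ^ Suc s * L ^ i)"
    using \<beta> by (intro sum_fraction_mean_below_power_le) (auto simp: \<beta>'_def)
  also have "\<dots> \<le> 2 * \<rho> ^ 3 * (real g - 1) ^ i + real g ^ 3 * ((real g * real D) * L ^ i)"
    using power_le L_ge by (intro add_left_mono mult_left_mono mult_right_mono) auto
  also have "\<dots> \<le> C\<^sub>F * ((real g - 1) ^ i + real D * L ^ i)"
    using g_ge \<rho>_nonneg L_ge by (simp add: C\<^sub>F_def algebra_simps power4_eq_xxxx power3_eq_cube)
  finally show ?thesis .
qed

end

section \<open>Divisor sums\<close>

lemma d2_le_small_divisors: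
  assumes "n > 0"
  shows "d2 n \<le> 2 * card {d. d dvd n \<and> d * d \<le> n}"
proof -
  define S where "S = {d. d dvd n \<and> d * d \<le> n}"
  have fin: "finite S" using assms by (simp add: S_def)
  have "{d. d dvd n} \<subseteq> S \<union> (\<lambda>d. n div d) ` S"
  proof
    fix d assume "d \<in> {d. d dvd n}"
    then obtain c where n_eq: "n = d * c" by auto
    show "d \<in> S \<union> (\<lambda>d. n div d) ` S"
    proof (cases "d \<le> c")
      case True
      thus ?thesis using n_eq by (auto simp: S_def)
    next
      case False
      hence "c \<in> S" using n_eq by (auto simp: S_def)
      moreover have "d = n div c" using n_eq assms by simp
      ultimately show ?thesis by blast
    qed
  qed
  hence "d2 n \<le> card (S \<union> (\<lambda>d. n div d) ` S)"
    unfolding d2_def using fin by (intro card_mono) auto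
  also have "\<dots> \<le> card S + card ((\<lambda>d. n div d) ` S)" by (rule card_Un_le)
  also have "\<dots> \<le> 2 * card S" using card_image_le[OF fin, of "\<lambda>d. n div d"] by simp
  finally show ?thesis by (simp add: S_def)
qed

lemma sum_e_multiples:
  assumes "d > 0"
  shows "(\<Sum>a=1..d. e (real n * (real a / real d))) = (if d dvd n then of_nat d else 0)"
proof -
  define z where "z = e (real n / real d)"
  have sum_eq: "(\<Sum>a=1..d. e (real n * (real a / real d))) = z * (\<Sum>a<d. z ^ a)"
  proof -
    have "e (real n * (real a / real d)) = z ^ a" for a
      by (simp add: z_def e_power mult.commute)
    thus ?thesis by (simp add: sum_distrib_left sum.atLeast1_atMost_eq)
  qed
  have z_power: "z ^ d = 1" using assms by (simp add: z_def e_power)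
  show ?thesis
  proof (cases "d dvd n")
    case True
    hence "z = 1" using assms by (auto simp: z_def)
    thus ?thesis unfolding sum_eq using True by simp
  next
    case False
    have "sin (pi * (real n / real d)) \<noteq> 0"
    proof
      assume "sin (pi * (real n / real d)) = 0"
      then obtain i where "pi * (real n / real d) = of_int i * pi"
        by (auto simp: sin_zero_iff_int2)
      hence "real_of_int (int n) = real_of_int (i * int d)" using assms by (simp add: field_simps)
      hence "int d dvd int n" unfolding of_int_eq_iff by simp
      thus False using False by simp
    qed
    hence "z \<noteq> 1" using norm_one_minus_e[of "real n / real d"] by (auto simp: z_def)
    thus ?thesis unfolding sum_eq using False z_power by (simp add: sum_gp_strict)
  qed
qed

lemma card_multiples_le:
  assumes "finite S" "d > 0"
  shows "real (card {n \<in> S. d dvd n}) \<le> (\<Sum>a=1..d. norm (exp_sum S (real a / real d))) / real d"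
proof -
  have "(\<Sum>a=1..d. exp_sum S (real a / real d)) = (\<Sum>n\<in>S. if d dvd n then of_nat d else 0)"
    unfolding exp_sum_def by (subst sum.swap) (intro sum.cong refl sum_e_multiples assms(2))
  also have "\<dots> = of_nat (d * card {n \<in> S. d dvd n})"
    using assms(1) by (simp add: sum.If_cases Int_def)
  finally have "norm (\<Sum>a=1..d. exp_sum S (real a / real d)) = real (d * card {n \<in> S. d dvd n})"
    by (simp only: norm_of_nat)
  hence "real d * real (card {n \<in> S. d dvd n}) \<le> (\<Sum>a=1..d. norm (exp_sum S (real a / real d)))"
    using norm_sum[of "\<lambda>a. exp_sum S (real a / real d)" "{1..d}"] by simp
  thus ?thesis using assms(2) by (simp add: field_simps)
qed

lemma sum_fractions_eq_sum_reduced: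
  fixes h :: "real \<Rightarrow> 'a::comm_monoid_add"
  assumes "d > 0"
  shows "(\<Sum>a=1..d. h (real a / real d)) = (\<Sum>q | q dvd d. \<Sum>a\<in>totatives q. h (real a / real q))"
proof -
  have "(\<Sum>a=1..d. h (real a / real d)) =
      (\<Sum>c | c dvd d. \<Sum>a | a \<in> {1..d} \<and> gcd a d = c. h (real a / real d))"
    using assms by (intro sum.group [symmetric]) auto
  also have "\<dots> = (\<Sum>c | c dvd d. \<Sum>a\<in>totatives (d div c). h (real a / real (d div c)))"
  proof (rule sum.cong, simp, clarify)
    fix c assume c_dvd: "c dvd d"
    have "(\<Sum>a | a \<in> {1..d} \<and> gcd a d = c. h (real a / real d)) =
        (\<Sum>a\<in>totatives (d div c). h (real (a * c) / real d))"
      using bij_betw_totatives_gcd_eq[OF c_dvd assms]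
      by (intro sum.reindex_bij_betw [symmetric]) (simp add: atLeastSucAtMost_greaterThanAtMost)
    also have "\<dots> = (\<Sum>a\<in>totatives (d div c). h (real a / real (d div c)))"
      using c_dvd assms by (auto elim!: dvdE)
    finally show "(\<Sum>a | a \<in> {1..d} \<and> gcd a d = c. h (real a / real d)) =
        (\<Sum>a\<in>totatives (d div c). h (real a / real (d div c)))" .
  qed
  also have "\<dots> = (\<Sum>q | q dvd d. \<Sum>a\<in>totatives q. h (real a / real q))"
    by (rule sum.reindex_bij_witness[of _ "\<lambda>q. d div q" "\<lambda>c. d div c"])
       (use assms in \<open>auto elim!: dvdE\<close>)
  finally show ?thesis .
qed

lemma sum_divisors_le_harm_mult:
  fixes f :: "nat \<Rightarrow> real"
  assumes "\<And>q. 0 \<le> f q"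
  shows "(\<Sum>d=1..D. (\<Sum>q | q dvd d. f q) / real d) \<le> harm D * (\<Sum>q=1..D. f q / real q)"
proof -
  have "(\<Sum>d=1..D. (\<Sum>q | q dvd d. f q) / real d) =
      (\<Sum>(d, q)\<in>(SIGMA d:{1..D}. {q. q dvd d}). f q / real d)"
    by (subst sum.Sigma [symmetric]) (auto simp: sum_divide_distrib)
  also have "\<dots> \<le> (\<Sum>(c, q)\<in>{1..D} \<times> {1..D}. inverse (real c) * (f q / real q))"
  proof (rule sum_le_included[where i = "\<lambda>(c, q). (c * q, q)"])
    show "\<forall>x\<in>(SIGMA d:{1..D}. {q. q dvd d}). \<exists>y\<in>{1..D} \<times> {1..D}.
        (case y of (c, q) \<Rightarrow> (c * q, q)) = x \<and>
        (case x of (d, q) \<Rightarrow> f q / real d) \<le> (case y of (c, q) \<Rightarrow> inverse (real c) * (f q / real q))"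
    proof clarify
      fix d q :: nat assume d_range: "d \<in> {1..D}" and "q dvd d"
      then obtain c where d_eq: "d = c * q" by (auto elim!: dvdE simp: mult.commute)
      have "c \<in> {1..D}" "q \<in> {1..D}"
        using d_range d_eq by (auto simp: Suc_le_eq intro: order.trans[of _ "c * q"])
      thus "\<exists>y\<in>{1..D} \<times> {1..D}. (case y of (c, q) \<Rightarrow> (c * q, q)) = (d, q) \<and>
          f q / real d \<le> (case y of (c, q) \<Rightarrow> inverse (real c) * (f q / real q))"
        using d_eq by (intro bexI[of _ "(c, q)"]) (auto simp: field_simps)
    qed
  qed (use assms in \<open>auto intro: finite_SigmaI\<close>)
  also have "\<dots> = harm D * (\<Sum>q=1..D. f q / real q)"
    by (simp add: harm_def sum_product flip: sum.cartesian_product)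
  finally show ?thesis .
qed

lemma sum_d2_le:
  assumes "finite S" and S: "\<And>n. n \<in> S \<Longrightarrow> 0 < n \<and> n < Suc D * Suc D"
  shows "(\<Sum>n\<in>S. real (d2 n)) \<le> 2 * (harm D * (\<Sum>q=1..D. fraction_mean S q 0))"
proof -
  have "real (d2 n) \<le> 2 * (\<Sum>d=1..D. if d dvd n then 1 else 0)" if "n \<in> S" for n
  proof -
    have "{d. d dvd n \<and> d * d \<le> n} \<subseteq> {d\<in>{1..D}. d dvd n}"
    proof clarify
      fix d assume small_divisor: "d dvd n" "d * d \<le> n"
      have "d * d < Suc D * Suc D" using small_divisor S[OF that] by linarith
      hence "d \<le> D" by (meson mult_le_mono not_less not_less_eq_eq)
      moreover have "d > 0" using small_divisor S[OF that] by (auto intro: Nat.gr0I)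
      ultimately show "d \<in> {1..D}" by simp
    qed
    hence "card {d. d dvd n \<and> d * d \<le> n} \<le> card {d\<in>{1..D}. d dvd n}" by (intro card_mono) auto
    hence "real (d2 n) \<le> 2 * real (card {d\<in>{1..D}. d dvd n})"
      using d2_le_small_divisors[of n] S[OF that] by linarith
    thus ?thesis by (simp add: sum.If_cases Int_def)
  qed
  hence "(\<Sum>n\<in>S. real (d2 n)) \<le> (\<Sum>n\<in>S. 2 * (\<Sum>d=1..D. if d dvd n then 1 else 0))"
    by (rule sum_mono)
  also have "\<dots> = 2 * (\<Sum>d=1..D. real (card {n\<in>S. d dvd n}))"
    unfolding sum_distrib_left [symmetric] using assms(1)
    by (subst sum.swap) (simp add: sum.If_cases Int_def)
  also have "(\<Sum>d=1..D. real (card {n\<in>S. d dvd n})) \<le>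
      (\<Sum>d=1..D. (\<Sum>a=1..d. norm (exp_sum S (real a / real d))) / real d)"
    using assms(1) by (intro sum_mono card_multiples_le) auto
  also have "\<dots> = (\<Sum>d=1..D. (\<Sum>q | q dvd d. \<Sum>a\<in>totatives q.
      norm (exp_sum S (real a / real q))) / real d)"
    by (intro sum.cong refl, subst sum_fractions_eq_sum_reduced) auto
  also have "\<dots> \<le> harm D * (\<Sum>q=1..D. (\<Sum>a\<in>totatives q. norm (exp_sum S (real a / real q))) / real q)"
    by (intro sum_divisors_le_harm_mult sum_nonneg norm_ge_zero)
  finally show ?thesis by (simp add: fraction_mean_def)
qed

section \<open>Major arcs\<close>

lemma continuous_on_e [continuous_intros]:
  "continuous_on S f \<Longrightarrow> continuous_on S (\<lambda>x. e (f x))"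
  unfolding e_def by (intro continuous_intros)

lemma e_has_vector_derivative:
  "((\<lambda>x. e (\<beta> * x)) has_vector_derivative
    (2 * of_real pi * \<i> * of_real \<beta>) * e (\<beta> * x)) (at x within S)"
  using exp_scaleR_has_vector_derivative_right[of "2 * of_real pi * \<i> * of_real \<beta>" x S]
  by (simp add: e_def scaleR_conv_of_real mult_ac)

lemma norm_integral_mult_e_le:
  fixes f f' :: "real \<Rightarrow> complex"
  assumes "u \<le> v"
    and f: "\<And>x. x \<in> {u..v} \<Longrightarrow> (f has_vector_derivative f' x) (at x within {u..v})"
    and f': "continuous_on {u..v} f'"
    and M: "\<And>x. x \<in> {u..v} \<Longrightarrow> norm (f x) \<le> M" and M': "\<And>x. x \<in> {u..v} \<Longrightarrow> norm (f' x) \<le> M'"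
  shows "2 * pi * \<bar>\<beta>\<bar> * norm (integral {u..v} (\<lambda>x. f x * e (\<beta> * x))) \<le> 2 * M + M' * (v - u)"
proof -
  define w where "w = 2 * of_real pi * \<i> * complex_of_real \<beta>"
  define F where "F = (\<lambda>x. f x * e (\<beta> * x))"
  define G where "G = (\<lambda>x. f' x * e (\<beta> * x))"
  have "continuous_on {u..v} f"
    using f by (meson continuous_on_eq_continuous_within has_vector_derivative_continuous)
  hence cont: "continuous_on {u..v} F" "continuous_on {u..v} G"
    using f' by (auto simp: F_def G_def intro!: continuous_intros)
  have "(F has_vector_derivative w * F x + G x) (at x within {u..v})" if "x \<in> {u..v}" for x
    using has_vector_derivative_mult[OF f[OF that] e_has_vector_derivative[of \<beta> x]]
    by (simp add: F_def G_def w_def mult_ac)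
  hence "((\<lambda>x. w * F x + G x) has_integral F v - F u) {u..v}"
    using assms(1) by (intro fundamental_theorem_of_calculus)
  moreover have "((\<lambda>x. w * F x + G x) has_integral
      w * integral {u..v} F + integral {u..v} G) {u..v}"
    using cont by (intro has_integral_add has_integral_mult_right integrable_integral
        integrable_continuous_interval)
  ultimately have "w * integral {u..v} F + integral {u..v} G = F v - F u"
    by (rule has_integral_unique [symmetric])
  hence "w * integral {u..v} F = F v - F u - integral {u..v} G"
    by (simp add: algebra_simps)
  hence "norm w * norm (integral {u..v} F) \<le> norm (F v) + norm (F u) + norm (integral {u..v} G)"
    using norm_triangle_ineq4[of "F v - F u" "integral {u..v} G"]
      norm_triangle_ineq4[of "F v" "F u"]
    by (simp flip: norm_mult)
  moreover have "norm (F v) \<le> M" "norm (F u) \<le> M"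
    using M assms(1) by (auto simp: F_def norm_mult)
  moreover have "norm (integral {u..v} G) \<le> M' * (v - u)"
    using assms(1) M' by (intro integral_bound cont) (auto simp: G_def norm_mult)
  ultimately show ?thesis by (simp add: w_def F_def norm_mult)
qed

lemma le_divide_sqrt_if_le_min:
  fixes y :: real
  assumes "0 < H" "0 \<le> y" "y \<le> M * H" "\<bar>\<beta>\<bar> * y \<le> M"
  shows "y \<le> 2 * M * (H / sqrt ((H * \<beta>) ^ 2 + 1))"
proof -
  have "sqrt ((H * \<beta>) ^ 2 + 1) \<le> H * \<bar>\<beta>\<bar> + 1"
    using sqrt_sum_squares_le_sum_abs[of "H * \<beta>" 1] assms(1) by (simp add: abs_mult)
  hence "y * sqrt ((H * \<beta>) ^ 2 + 1) \<le> y * (H * \<bar>\<beta>\<bar> + 1)"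
    using assms(2) by (rule mult_left_mono)
  also have "\<dots> = H * (\<bar>\<beta>\<bar> * y) + y" by (simp add: algebra_simps)
  also have "\<dots> \<le> H * M + M * H"
    using assms by (intro add_mono mult_left_mono) auto
  finally have "y * sqrt ((H * \<beta>) ^ 2 + 1) \<le> 2 * M * H" by (simp add: mult_ac)
  moreover have "0 < sqrt ((H * \<beta>) ^ 2 + 1)" by (simp add: add_nonneg_pos)
  ultimately show ?thesis by (simp add: pos_le_divide_eq)
qed

lemma arsinh_le_ln:
  assumes "(y::real) \<ge> 0"
  shows "arsinh y \<le> ln (2 * y + 1)"
  using sqrt_sum_squares_le_sum_abs[of y 1] assms arsinh_real_aux[of y]
  by (simp add: arsinh_real_def)

lemma has_integral_arsinh:
  assumes "\<delta> > 0"
  shows "((\<lambda>\<beta>. H / sqrt ((H * \<beta>) ^ 2 + 1)) has_integral 2 * arsinh (H * \<delta>)) {\<beta>. \<bar>\<beta>\<bar> < \<delta>}"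
proof -
  have "((\<lambda>\<beta>. H / sqrt ((H * \<beta>) ^ 2 + 1)) has_integral (arsinh (H * \<delta>) - arsinh (H * - \<delta>))) {-\<delta>..\<delta>}"
  proof (rule fundamental_theorem_of_calculus)
    fix x :: real
    have "((\<lambda>\<beta>. arsinh (H * \<beta>)) has_real_derivative
        1 / sqrt ((H * x) ^ 2 + 1) * H) (at x within {-\<delta>..\<delta>})"
      by (rule DERIV_chain2[OF arsinh_real_has_field_derivative])
         (auto intro!: derivative_eq_intros)
    thus "((\<lambda>\<beta>. arsinh (H * \<beta>)) has_vector_derivative
        H / sqrt ((H * x) ^ 2 + 1)) (at x within {-\<delta>..\<delta>})"
      by (simp add: has_real_derivative_iff_has_vector_derivative)
  qed (use assms in simp)
  moreover have "{\<beta>. \<bar>\<beta>\<bar> < \<delta>} = {-\<delta><..<\<delta>}" by auto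
  ultimately show ?thesis
    by (simp add: has_integral_Icc_iff_Ioo)
qed

lemma norm_integral_le_arsinh:
  fixes f :: "real \<Rightarrow> 'a::euclidean_space"
  assumes "H > 0" "\<delta> > 0" "B \<ge> 0"
    and f: "\<And>\<beta>. \<bar>\<beta>\<bar> < \<delta> \<Longrightarrow> norm (f \<beta>) \<le> B * (H / sqrt ((H * \<beta>) ^ 2 + 1))"
  shows "norm (integral {\<beta>. \<bar>\<beta>\<bar> < \<delta>} f) \<le> B * (2 * arsinh (H * \<delta>))"
proof (cases "f integrable_on {\<beta>. \<bar>\<beta>\<bar> < \<delta>}")
  case True
  have majorant: "((\<lambda>\<beta>. B * (H / sqrt ((H * \<beta>) ^ 2 + 1)))
      has_integral B * (2 * arsinh (H * \<delta>))) {\<beta>. \<bar>\<beta>\<bar> < \<delta>}"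
    using assms(2) by (intro has_integral_mult_right has_integral_arsinh)
  show ?thesis
    using integral_norm_bound_integral[OF True has_integral_integrable[OF majorant]] f majorant
    by (simp add: integral_unique)
next
  case False
  have "0 < arsinh (H * \<delta>)" using assms by (simp only: arsinh_real_pos_iff mult_pos_pos)
  hence "0 \<le> B * (2 * arsinh (H * \<delta>))" using assms(3)
    by (metis less_imp_le mult_nonneg_nonneg zero_le_numeral)
  thus ?thesis by (simp only: not_integrable_integral[OF False] norm_zero)
qed

definition p2_star_transform :: "nat \<Rightarrow> real \<Rightarrow> real \<Rightarrow> real \<Rightarrow> complex" where
  "p2_star_transform q X H \<beta> = integral {X..X + H} (\<lambda>x. of_real (p2_star q x) * e (\<beta> * x))"

definition twisted_sum :: "nat set \<Rightarrow> nat \<Rightarrow> real \<Rightarrow> complex" where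
  "twisted_sum A q \<beta> = (\<Sum>n\<in>A. ramanujan_sum q n * e (- (real n * \<beta>)))"

lemma major_arc_term_eq:
  "major_arc_term A X H P Q = (\<Sum>q | 1 \<le> q \<and> real q \<le> P.
    integral {\<beta>. \<bar>\<beta>\<bar> < 1 / (real q * Q)} (\<lambda>\<beta>. p2_star_transform q X H \<beta> * twisted_sum A q \<beta>))"
  by (simp add: major_arc_term_def p2_star_transform_def twisted_sum_def)

lemma ln_ge_1: "3 \<le> (x::real) \<Longrightarrow> 1 \<le> ln x"
  using exp_le by (subst ln_ge_iff) auto

lemma abs_p2_star_le:
  assumes "3 \<le> X" "X \<le> x" "x \<le> 2 * X" "1 \<le> q" "real q ^ 4 \<le> X"
  shows "\<bar>p2_star q x\<bar> \<le> 4 * ln X / real q"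
proof -
  have "1 \<le> ln X" using assms(1) by (rule ln_ge_1)
  moreover have "ln X \<le> ln x" using assms by simp
  moreover have "ln x \<le> ln (2 * X)" using assms by (subst ln_le_cancel_iff) auto
  moreover have "ln (2 * X) \<le> 1 + ln X" using assms ln_2_less_1 by (simp add: ln_mult)
  moreover have "ln (real q ^ 4) \<le> ln X" using assms by (subst ln_le_cancel_iff) auto
  hence "4 * ln (real q) \<le> ln X" using assms by (simp add: ln_realpow)
  moreover have "0 \<le> ln (real q)" using assms by simp
  ultimately have "\<bar>ln x + 2 * euler_mascheroni - 2 * ln (real q)\<bar> \<le> 4 * ln X"
    using euler_mascheroni_less_13_over_22 euler_mascheroni_pos by linarith
  thus ?thesis by (simp add: p2_star_def abs_mult divide_right_mono)
qed

lemma norm_p2_star_transform_le: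
  assumes X: "3 \<le> X" and H: "0 < H" "H \<le> X" and q: "1 \<le> q" "real q ^ 4 \<le> X"
  shows "norm (p2_star_transform q X H \<beta>) \<le>
    8 * ln X / real q * (H / sqrt ((H * \<beta>) ^ 2 + 1))"
proof -
  define M where "M = 4 * ln X / real q"
  define y where "y = norm (p2_star_transform q X H \<beta>)"
  have lnX: "1 \<le> ln X" using X by (rule ln_ge_1)
  have p_le: "norm (complex_of_real (p2_star q x)) \<le> M" if "x \<in> {X..X + H}" for x
    using abs_p2_star_le[OF X _ _ q, of x] that H by (simp add: M_def)
  have deriv: "((\<lambda>x. complex_of_real (p2_star q x)) has_vector_derivative
      of_real (1 / (real q * x))) (at x within {X..X + H})" if "x \<in> {X..X + H}" for x
    unfolding p2_star_def using that X q
    by (intro has_vector_derivative_of_real) (auto intro!: derivative_eq_intros)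
  have "y \<le> M * (X + H - X)"
    unfolding y_def p2_star_transform_def
  proof (rule integral_bound)
    show "continuous_on {X..X + H} (\<lambda>x. complex_of_real (p2_star q x) * e (\<beta> * x))"
      unfolding p2_star_def using X by (intro continuous_intros) auto
  qed (use H p_le in \<open>auto simp: norm_mult\<close>)
  moreover have "2 * pi * \<bar>\<beta>\<bar> * y \<le> 2 * M + 1 / (real q * X) * (X + H - X)"
    unfolding y_def p2_star_transform_def
  proof (rule norm_integral_mult_e_le[OF _ deriv _ p_le])
    show "norm (complex_of_real (1 / (real q * x))) \<le> 1 / (real q * X)" if "x \<in> {X..X + H}" for x
      using that X q by (simp add: norm_divide norm_mult divide_left_mono)
    show "continuous_on {X..X + H} (\<lambda>x. complex_of_real (1 / (real q * x)))"
      using X q by (intro continuous_intros) auto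
  qed (use H in auto)
  moreover have "1 / (real q * X) * H \<le> M"
  proof -
    have "1 / (real q * X) * H \<le> 1 / real q" using X H q by (simp add: field_simps)
    also have "\<dots> \<le> M" using lnX q by (simp add: M_def divide_right_mono)
    finally show ?thesis .
  qed
  moreover have "3 * \<bar>\<beta>\<bar> * y \<le> 2 * pi * \<bar>\<beta>\<bar> * y"
    using pi_gt3 by (intro mult_right_mono) (auto simp: y_def)
  ultimately have "y \<le> M * H" "\<bar>\<beta>\<bar> * y \<le> M" by (simp_all add: algebra_simps)
  hence "y \<le> 2 * M * (H / sqrt ((H * \<beta>) ^ 2 + 1))"
    using H by (intro le_divide_sqrt_if_le_min) (auto simp: y_def)
  thus ?thesis by (simp add: y_def M_def)
qed

lemma norm_major_arc_integral_le:
  assumes X: "3 \<le> X" and H: "0 < H" "H \<le> X" and q: "1 \<le> q" "real q ^ 4 \<le> X" and \<delta>: "0 < \<delta>" "\<delta> \<le> 1"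
    and W: "\<And>\<beta>. \<bar>\<beta>\<bar> \<le> \<delta> \<Longrightarrow> norm (twisted_sum A q \<beta>) \<le> W"
  shows "norm (integral {\<beta>. \<bar>\<beta>\<bar> < \<delta>} (\<lambda>\<beta>. p2_star_transform q X H \<beta> * twisted_sum A q \<beta>)) \<le>
    32 * ln X ^ 2 * (W / real q)"
proof -
  define B where "B = 8 * ln X / real q * W"
  have "norm (twisted_sum A q 0) \<le> W" using W \<delta> by simp
  hence W_nonneg: "0 \<le> W" by (rule order.trans[OF norm_ge_zero])
  have B_nonneg: "0 \<le> B" using W_nonneg X by (simp add: B_def)
  have "norm (integral {\<beta>. \<bar>\<beta>\<bar> < \<delta>} (\<lambda>\<beta>. p2_star_transform q X H \<beta> * twisted_sum A q \<beta>)) \<le>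
      B * (2 * arsinh (H * \<delta>))"
  proof (rule norm_integral_le_arsinh[OF H(1) \<delta>(1) B_nonneg])
    fix \<beta> :: real assume "\<bar>\<beta>\<bar> < \<delta>"
    hence "norm (p2_star_transform q X H \<beta> * twisted_sum A q \<beta>) \<le>
        8 * ln X / real q * (H / sqrt ((H * \<beta>) ^ 2 + 1)) * W"
      unfolding norm_mult using X H q W_nonneg
      by (intro mult_mono norm_p2_star_transform_le W) auto
    thus "norm (p2_star_transform q X H \<beta> * twisted_sum A q \<beta>) \<le>
        B * (H / sqrt ((H * \<beta>) ^ 2 + 1))"
      by (simp add: B_def mult_ac)
  qed
  also have "arsinh (H * \<delta>) \<le> 2 * ln X"
  proof -
    have "H * \<delta> \<le> X * 1" using H \<delta> by (intro mult_mono) auto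
    moreover have "3 * X \<le> X ^ 2" using X by (simp add: power2_eq_square)
    ultimately have arg_le: "2 * (H * \<delta>) + 1 \<le> X ^ 2" using X by linarith
    have "arsinh (H * \<delta>) \<le> ln (2 * (H * \<delta>) + 1)" using H \<delta> by (intro arsinh_le_ln) auto
    also have "\<dots> \<le> ln (X ^ 2)"
      using arg_le H \<delta> X by (subst ln_le_cancel_iff) (auto intro: add_nonneg_pos)
    finally show ?thesis using X by (simp add: ln_realpow)
  qed
  hence "B * (2 * arsinh (H * \<delta>)) \<le> B * (2 * (2 * ln X))"
    using B_nonneg by (intro mult_left_mono) auto
  finally show ?thesis by (simp add: B_def power2_eq_square mult_ac)
qed

lemma norm_twisted_sum_le_fraction_mean:
  assumes "1 \<le> q"
  shows "norm (twisted_sum A q \<beta>) / real q \<le> fraction_mean A q \<beta>"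
proof -
  have "{a. 1 \<le> a \<and> a \<le> q \<and> coprime a q} = totatives q"
    by (auto simp: in_totatives_iff)
  hence "twisted_sum A q \<beta> = (\<Sum>n\<in>A. \<Sum>a\<in>totatives q. e (real n * (real a / real q - \<beta>)))"
    unfolding twisted_sum_def ramanujan_sum_def sum_distrib_right e_add [symmetric]
    by (simp add: algebra_simps)
  also have "\<dots> = (\<Sum>a\<in>totatives q. exp_sum A (real a / real q - \<beta>))"
    unfolding exp_sum_def by (rule sum.swap)
  finally show ?thesis
    using assms by (simp add: fraction_mean_def norm_sum divide_right_mono)
qed

lemma twisted_sum_attains_sup:
  assumes "\<delta> \<ge> 0"
  shows "\<exists>\<beta>'. \<bar>\<beta>'\<bar> \<le> \<delta> \<and>
    (\<forall>\<beta>. \<bar>\<beta>\<bar> \<le> \<delta> \<longrightarrow> norm (twisted_sum A q \<beta>) \<le> norm (twisted_sum A q \<beta>'))"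
proof -
  have "continuous_on {-\<delta>..\<delta>} (\<lambda>\<beta>. norm (twisted_sum A q \<beta>))"
    unfolding twisted_sum_def by (intro continuous_intros)
  then obtain x where "x \<in> {-\<delta>..\<delta>}"
    "\<forall>y\<in>{-\<delta>..\<delta>}. norm (twisted_sum A q y) \<le> norm (twisted_sum A q x)"
    using continuous_attains_sup[of "{-\<delta>..\<delta>}" "\<lambda>\<beta>. norm (twisted_sum A q \<beta>)"] assms by auto
  thus ?thesis by (intro exI[of _ x]) (auto simp: abs_le_iff)
qed

lemma norm_major_arc_term_le:
  assumes X: "3 \<le> X" and H: "0 < H" "H \<le> X" and P: "1 \<le> P" "P ^ 4 \<le> X" and Q: "1 \<le> Q"
  obtains \<beta> where "\<And>q. \<bar>\<beta> q\<bar> \<le> 1 / (real q * Q)"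
    and "norm (major_arc_term A X H P Q) \<le>
      32 * ln X ^ 2 * (\<Sum>q=1..nat \<lfloor>P\<rfloor>. fraction_mean A q (\<beta> q))"
proof -
  have "\<exists>\<beta>'. \<bar>\<beta>'\<bar> \<le> 1 / (real q * Q) \<and>
      (\<forall>\<beta>. \<bar>\<beta>\<bar> \<le> 1 / (real q * Q) \<longrightarrow> norm (twisted_sum A q \<beta>) \<le> norm (twisted_sum A q \<beta>'))" for q
    using Q by (intro twisted_sum_attains_sup) simp
  then obtain \<beta> where \<beta>: "\<And>q. \<bar>\<beta> q\<bar> \<le> 1 / (real q * Q)"
    and attains_sup: "\<And>q \<theta>. \<bar>\<theta>\<bar> \<le> 1 / (real q * Q) \<Longrightarrow>
      norm (twisted_sum A q \<theta>) \<le> norm (twisted_sum A q (\<beta> q))"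
    by metis
  have moduli: "{q. 1 \<le> q \<and> real q \<le> P} = {1..nat \<lfloor>P\<rfloor>}"
    using P by (auto simp: le_nat_iff le_floor_iff)
  have "norm (major_arc_term A X H P Q) \<le> (\<Sum>q=1..nat \<lfloor>P\<rfloor>. 32 * ln X ^ 2 * fraction_mean A q (\<beta> q))"
    unfolding major_arc_term_eq moduli
  proof (rule order.trans[OF norm_sum], rule sum_mono)
    fix q assume "q \<in> {1..nat \<lfloor>P\<rfloor>}"
    hence q: "1 \<le> q" "real q \<le> P" unfolding moduli [symmetric] by auto
    hence "real q ^ 4 \<le> P ^ 4" by (intro power_mono) auto
    hence "real q ^ 4 \<le> X" using P(2) by linarith
    moreover have "1 * 1 \<le> real q * Q" using q Q by (intro mult_mono) auto
    ultimately have "norm (integral {\<beta>. \<bar>\<beta>\<bar> < 1 / (real q * Q)}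
        (\<lambda>\<beta>. p2_star_transform q X H \<beta> * twisted_sum A q \<beta>)) \<le>
        32 * ln X ^ 2 * (norm (twisted_sum A q (\<beta> q)) / real q)"
      using X H q by (intro norm_major_arc_integral_le attains_sup) auto
    also have "\<dots> \<le> 32 * ln X ^ 2 * fraction_mean A q (\<beta> q)"
      using q by (intro mult_left_mono norm_twisted_sum_le_fraction_mean) auto
    finally show "norm (integral {\<beta>. \<bar>\<beta>\<bar> < 1 / (real q * Q)}
        (\<lambda>\<beta>. p2_star_transform q X H \<beta> * twisted_sum A q \<beta>)) \<le>
        32 * ln X ^ 2 * fraction_mean A q (\<beta> q)" .
  qed
  thus ?thesis using \<beta> by (intro that) (simp_all add: sum_distrib_left)
qed

section \<open>Short intervals\<close>

context missing_digit
begin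

lemma mem_missing_digit_interval_iff:
  "n \<in> missing_digit_interval g b Y Z \<longleftrightarrow> Y < real n \<and> real n \<le> Z \<and> avoids n"
  by (simp add: missing_digit_interval_def base_digits_subset_iff)

lemma finite_missing_digit_interval: "finite (missing_digit_interval g b Y Z)"
proof (rule finite_subset)
  show "missing_digit_interval g b Y Z \<subseteq> {..nat \<lfloor>Z\<rfloor>}"
    by (auto simp: mem_missing_digit_interval_iff le_nat_floor)
qed simp

lemma missing_digit_interval_0_eq:
  assumes "0 \<le> H"
  shows "missing_digit_interval g b 0 H = below (Suc (nat \<lfloor>H\<rfloor>)) - {0}"
  using assms
  by (auto simp: mem_missing_digit_interval_iff below_def less_Suc_eq_le le_nat_iff le_floor_iff)

lemma avoids_power:
  assumes "b \<noteq> 1"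
  shows "avoids (g ^ i)"
  using avoids_mult_power_add[of 0 i 1] assms g_ge_2 by simp

lemma missing_digit_interval_0_eq_insert:
  assumes "b \<noteq> 1" "1 \<le> H"
  shows "missing_digit_interval g b 0 H = insert 1 (missing_digit_interval g b 1 H)"
  using avoids_power[OF assms(1), of 0] assms(2)
  by (auto simp: mem_missing_digit_interval_iff)

lemma missing_digit_interval_translate:
  assumes "b \<noteq> 1" "H < real g ^ k"
  shows "missing_digit_interval g b (real g ^ k) (real g ^ k + H) =
    (+) (g ^ k) ` missing_digit_interval g b 0 H"
proof -
  have avoids: "avoids (g ^ k + m) \<longleftrightarrow> avoids m" if "real m \<le> H" for m
  proof -
    have "real m < real (g ^ k)" using that assms(2) unfolding of_nat_power by linarith
    hence "m < g ^ k" by (simp only: of_nat_less_iff)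
    thus ?thesis using avoids_mult_power_add[of m k 1] assms(1) g_ge_2 by simp
  qed
  show ?thesis
  proof (intro equalityI subsetI)
    fix n assume "n \<in> missing_digit_interval g b (real g ^ k) (real g ^ k + H)"
    hence n_range: "real (g ^ k) < real n" "real n \<le> real (g ^ k) + H" "avoids n"
      by (simp_all add: mem_missing_digit_interval_iff)
    then obtain m where "n = g ^ k + m" "m > 0"
      unfolding of_nat_less_iff by (metis less_imp_add_positive)
    thus "n \<in> (+) (g ^ k) ` missing_digit_interval g b 0 H"
      using n_range avoids[of m] by (auto simp: mem_missing_digit_interval_iff)
  qed (auto simp: mem_missing_digit_interval_iff avoids)
qed

lemma power_le_card_missing_digit_interval:
  assumes "b \<noteq> 1" "real g ^ j \<le> H"
  shows "(g - 1) ^ j \<le> card (missing_digit_interval g b 0 H)"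
proof -
  have less: "real m < real g ^ j" if "m < g ^ j" for m
    using that by (simp flip: of_nat_power)
  have "insert (g ^ j) (below (g ^ j) - {0}) \<subseteq> missing_digit_interval g b 0 H"
    using avoids_power[OF assms(1), of j] assms(2) g_ge_2
    by (auto simp: mem_missing_digit_interval_iff below_def dest: less)
  hence "card (insert (g ^ j) (below (g ^ j) - {0})) \<le> card (missing_digit_interval g b 0 H)"
    by (intro card_mono finite_missing_digit_interval)
  moreover have "0 \<in> below (g ^ j)" "g ^ j \<notin> below (g ^ j)"
    using g_ge_2 by (auto simp: below_def)
  ultimately show ?thesis
    using g_ge_2 by (simp add: card_below_power)
qed

lemma norm_exp_sum_missing_digit_interval_le:
  assumes "0 \<le> H" "H < real g ^ J"
  shows "norm (exp_sum (missing_digit_interval g b 0 H) x) \<le>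
    (real g + 1) * (\<Sum>i\<le>J. norm (exp_sum (below (g ^ i)) x))"
proof -
  define N where "N = Suc (nat \<lfloor>H\<rfloor>)"
  have "real (nat \<lfloor>H\<rfloor>) < real (g ^ J)" using assms by (simp add: floor_less_iff) linarith
  hence "nat \<lfloor>H\<rfloor> < g ^ J" by (simp only: of_nat_less_iff)
  hence "N \<le> g ^ J" by (simp add: N_def)
  also have "\<dots> < g ^ Suc J" using g_ge_2 by simp
  finally have N_less: "N < g ^ Suc J" .
  have "0 \<in> below N" by (simp add: N_def below_def)
  hence "exp_sum (missing_digit_interval g b 0 H) x = exp_sum (below N) x - 1"
    by (simp add: missing_digit_interval_0_eq[OF assms(1)] exp_sum_def sum_diff1 flip: N_def)
  hence "norm (exp_sum (missing_digit_interval g b 0 H) x) \<le> norm (exp_sum (below N) x) + 1"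
    using norm_triangle_ineq4[of "exp_sum (below N) x" 1] by simp
  also have "norm (exp_sum (below N) x) \<le> real g * (\<Sum>i<Suc J. norm (exp_sum (below (g ^ i)) x))"
    using N_less by (rule norm_exp_sum_below_le)
  also have "1 \<le> (\<Sum>i\<le>J. norm (exp_sum (below (g ^ i)) x))"
    using member_le_sum[of 0 "{..J}" "\<lambda>i. norm (exp_sum (below (g ^ i)) x)"]
    by (simp add: exp_sum_def)
  finally show ?thesis by (simp add: algebra_simps lessThan_Suc_atMost)
qed

lemma fraction_mean_missing_digit_interval_le:
  assumes "0 \<le> H" "H < real g ^ J"
  shows "fraction_mean (missing_digit_interval g b 0 H) q \<beta> \<le>
    (real g + 1) * (\<Sum>i\<le>J. fraction_mean (below (g ^ i)) q \<beta>)"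
proof -
  have "(\<Sum>a\<in>totatives q. norm (exp_sum (missing_digit_interval g b 0 H) (real a / real q - \<beta>))) \<le>
      (\<Sum>a\<in>totatives q. (real g + 1) * (\<Sum>i\<le>J. norm (exp_sum (below (g ^ i)) (real a / real q - \<beta>))))"
    by (intro sum_mono norm_exp_sum_missing_digit_interval_le assms)
  also have "\<dots> = (real g + 1) *
      (\<Sum>i\<le>J. \<Sum>a\<in>totatives q. norm (exp_sum (below (g ^ i)) (real a / real q - \<beta>)))"
    by (subst sum.swap) (simp only: sum_distrib_left)
  finally show ?thesis
    by (simp add: fraction_mean_def divide_right_mono flip: sum_divide_distrib)
qed

end

context large_base
begin

lemma sum_fraction_mean_interval_le:
  assumes "0 \<le> H" "H < real g ^ J" "1 \<le> D"
    and \<beta>: "\<And>q. q \<in> {1..D} \<Longrightarrow> \<bar>\<beta> q\<bar> \<le> 1 / (4 * real g * real q ^ 2)"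
  shows "(\<Sum>q=1..D. fraction_mean (missing_digit_interval g b 0 H) q (\<beta> q)) \<le>
    2 * (real g + 1) * C\<^sub>F * ((real g - 1) ^ J + real D * L ^ J)"
proof -
  have powers: "(\<Sum>i\<le>J. x ^ i) \<le> 2 * x ^ J" if "2 \<le> x" for x :: real
    using sum_power_le[OF that, of J] by (simp flip: lessThan_Suc_atMost)
  have "(\<Sum>q=1..D. fraction_mean (missing_digit_interval g b 0 H) q (\<beta> q)) \<le>
      (\<Sum>q=1..D. (real g + 1) * (\<Sum>i\<le>J. fraction_mean (below (g ^ i)) q (\<beta> q)))"
    by (intro sum_mono fraction_mean_missing_digit_interval_le assms)
  also have "\<dots> = (real g + 1) * (\<Sum>i\<le>J. \<Sum>q=1..D. fraction_mean (below (g ^ i)) q (\<beta> q))"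
    by (subst sum.swap) (simp only: sum_distrib_left)
  also have "\<dots> \<le> (real g + 1) * (\<Sum>i\<le>J. C\<^sub>F * ((real g - 1) ^ i + real D * L ^ i))"
    using \<beta> by (intro mult_left_mono sum_mono sum_fraction_mean_below_le assms(3)) auto
  also have "\<dots> = (real g + 1) * (C\<^sub>F * ((\<Sum>i\<le>J. (real g - 1) ^ i) + real D * (\<Sum>i\<le>J. L ^ i)))"
    by (simp add: sum_distrib_left sum.distrib distrib_left)
  also have "\<dots> \<le> (real g + 1) * (C\<^sub>F * (2 * (real g - 1) ^ J + real D * (2 * L ^ J)))"
    using g_ge L_ge C\<^sub>F_nonneg by (intro mult_left_mono add_mono powers) auto
  finally show ?thesis by (simp add: algebra_simps)
qed

definition prescribed_size :: "real \<Rightarrow> real" where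
  "prescribed_size X = (X / (ln X) ^ 3) powr (1 / (2 * lambda_exp g))"

text \<open>This is where the exponent \<open>1 / (2 \<lambda>)\<close> in the size of \<open>[1, H]\<^sup>*\<close> is used:
  \<open>(g - 1) powr (1 - \<lambda>) = L\<close>.\<close>

lemma sqrt_mult_L_power_le:
  assumes X: "1 < X" and size: "prescribed_size X \<le> a" and a: "(real g - 1) ^ j \<le> a"
  shows "sqrt X * L ^ j \<le> a * ln X powr (3 / 2)"
proof -
  define \<tau> where "\<tau> = lambda_exp g"
  define l where "l = ln X"
  have l_pos: "0 < l" using X by (simp add: l_def)
  have \<tau>_bounds: "2 / 3 \<le> \<tau>" "\<tau> \<le> 1"
    using lambda_ge g_ge L_ge unfolding \<tau>_def lambda_exp_def L_def [symmetric] by simp_all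
  have a_pos: "0 < a"
    using a g_ge by (intro less_le_trans[OF _ a]) simp
  have "(1 - \<tau>) * ln (real g - 1) = ln L"
    using g_ge unfolding \<tau>_def lambda_exp_def L_def by simp
  hence "L = (real g - 1) powr (1 - \<tau>)"
    using g_ge L_ge by (simp add: powr_def)
  hence "L ^ j = ((real g - 1) ^ j) powr (1 - \<tau>)"
    using g_ge by (simp add: powr_powr powr_power mult.commute flip: powr_realpow)
  also have "\<dots> \<le> a powr (1 - \<tau>)"
    using a g_ge \<tau>_bounds by (intro powr_mono2) auto
  finally have L_power: "L ^ j \<le> a powr (1 - \<tau>)" .
  have "sqrt (X / l ^ 3) = ((X / l ^ 3) powr (1 / (2 * \<tau>))) powr \<tau>"
    using \<tau>_bounds X l_pos by (simp add: powr_powr powr_half_sqrt)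
  also have "\<dots> \<le> a powr \<tau>"
    using size \<tau>_bounds unfolding prescribed_size_def \<tau>_def l_def by (intro powr_mono2) auto
  finally have "sqrt (X / l ^ 3) * L ^ j \<le> a powr \<tau> * a powr (1 - \<tau>)"
    using L_power L_ge X l_pos by (intro mult_mono) auto
  also have "\<dots> = a" using a_pos by (simp flip: powr_add)
  finally have "l powr (3 / 2) * (sqrt (X / l ^ 3) * L ^ j) \<le> l powr (3 / 2) * a"
    by (intro mult_left_mono) auto
  moreover have "sqrt (l ^ 3) = (l powr 3) powr (1 / 2)"
    using l_pos by (simp add: powr_half_sqrt powr_numeral)
  hence "sqrt (l ^ 3) = l powr (3 / 2)" unfolding powr_powr by simp
  hence "sqrt X = l powr (3 / 2) * sqrt (X / l ^ 3)"
    using l_pos by (simp add: real_sqrt_divide)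
  ultimately show ?thesis by (simp add: l_def mult_ac)
qed

definition C\<^sub>I :: real where
  "C\<^sub>I = 2 * (real g + 1) * C\<^sub>F * (real g * L)"

lemma C\<^sub>I_nonneg: "0 \<le> C\<^sub>I"
  using C\<^sub>F_nonneg L_ge by (simp add: C\<^sub>I_def)

end

locale short_interval = large_base +
  fixes k j :: nat and H :: real
  assumes b_not_1: "b \<noteq> 1" and j_less: "j < k"
    and H_ge: "real g ^ j \<le> H" and H_less: "H < real g ^ Suc j"
    and size_le: "prescribed_size (real g ^ k) \<le> real (card (missing_digit_interval g b 0 H))"
begin

definition X :: real where
  "X = real g ^ k"

definition A :: "nat set" where
  "A = missing_digit_interval g b X (X + H)"

lemma X_ge: "9 \<le> X"
proof -
  have "real g ^ 1 \<le> X"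
    unfolding X_def using g_ge j_less by (intro power_increasing) auto
  thus ?thesis using g_ge by simp
qed

lemma ln_X_ge: "1 \<le> ln X"
  using X_ge by (intro ln_ge_1) simp

lemma H_ge_1: "1 \<le> H"
  using H_ge g_ge one_le_power[of "real g" j] by linarith

lemma H_less_X: "H < X"
proof -
  have "real g ^ Suc j \<le> X"
    unfolding X_def using g_ge j_less by (intro power_increasing) auto
  thus ?thesis using H_less by linarith
qed

lemma A_eq: "A = (+) (g ^ k) ` missing_digit_interval g b 0 H"
  unfolding A_def X_def using H_less_X b_not_1
  by (intro missing_digit_interval_translate) (auto simp: X_def)

lemma card_A: "card A = card (missing_digit_interval g b 0 H)"
  unfolding A_eq by (rule card_image) simp

lemma power_le_card_A: "(real g - 1) ^ j \<le> real (card A)"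
proof -
  have "real ((g - 1) ^ j) \<le> real (card A)"
    unfolding card_A using b_not_1 H_ge by (intro of_nat_mono power_le_card_missing_digit_interval)
  thus ?thesis using g_ge by (simp add: of_nat_diff)
qed

lemma sqrt_X_mult_L_power_le: "sqrt X * L ^ j \<le> real (card A) * ln X powr (3 / 2)"
  using X_ge size_le power_le_card_A by (intro sqrt_mult_L_power_le) (auto simp: card_A X_def)

lemma sum_fraction_mean_A_le:
  assumes "1 \<le> D" and \<beta>: "\<And>q. q \<in> {1..D} \<Longrightarrow> \<bar>\<beta> q\<bar> \<le> 1 / (4 * real g * real q ^ 2)"
  shows "(\<Sum>q=1..D. fraction_mean A q (\<beta> q)) \<le> C\<^sub>I * (real (card A) + real D * L ^ j)"
proof -
  have "real g - 1 \<le> real g * L" "L \<le> real g * L"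
    using g_ge L_ge mult_left_mono[of 1 L "real g"] mult_right_mono[of 1 "real g" L] by linarith+
  hence "(real g - 1) * (real g - 1) ^ j + L * (real D * L ^ j) \<le>
      (real g * L) * real (card A) + (real g * L) * (real D * L ^ j)"
    using power_le_card_A g_ge L_ge by (intro add_mono mult_mono) auto
  hence powers: "(real g - 1) ^ Suc j + real D * L ^ Suc j \<le>
      (real g * L) * (real (card A) + real D * L ^ j)"
    by (simp add: distrib_left mult_ac)
  have "(\<Sum>q=1..D. fraction_mean A q (\<beta> q)) \<le>
      2 * (real g + 1) * C\<^sub>F * ((real g - 1) ^ Suc j + real D * L ^ Suc j)"
    unfolding A_eq fraction_mean_translate
    using H_ge_1 H_less assms by (intro sum_fraction_mean_interval_le) auto
  also have "\<dots> \<le> 2 * (real g + 1) * C\<^sub>F * ((real g * L) * (real (card A) + real D * L ^ j))"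
    using C\<^sub>F_nonneg by (intro mult_left_mono powers) auto
  finally show ?thesis by (simp add: C\<^sub>I_def mult.assoc)
qed

lemma sum_fraction_mean_A_le_of_le_sqrt:
  assumes "1 \<le> D" "real D \<le> 2 * sqrt X"
  shows "(\<Sum>q=1..D. fraction_mean A q 0) \<le> 3 * C\<^sub>I * real (card A) * ln X powr (3 / 2)"
proof -
  have "real D * L ^ j \<le> 2 * sqrt X * L ^ j" using assms L_ge by (intro mult_right_mono) auto
  moreover have "1 \<le> ln X powr (3 / 2)" using ln_X_ge by (intro ge_one_powr_ge_zero) auto
  hence "real (card A) * 1 \<le> real (card A) * ln X powr (3 / 2)" by (intro mult_left_mono) auto
  ultimately have "real (card A) + real D * L ^ j \<le> 3 * (real (card A) * ln X powr (3 / 2))"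
    using sqrt_X_mult_L_power_le by simp
  hence "C\<^sub>I * (real (card A) + real D * L ^ j) \<le> C\<^sub>I * (3 * (real (card A) * ln X powr (3 / 2)))"
    using C\<^sub>I_nonneg by (rule mult_left_mono)
  moreover have "(\<Sum>q=1..D. fraction_mean A q 0) \<le> C\<^sub>I * (real (card A) + real D * L ^ j)"
    using sum_fraction_mean_A_le[of D "\<lambda>_. 0"] assms(1) by simp
  ultimately show ?thesis by simp
qed

lemma sum_d2_A_le:
  "(\<Sum>n\<in>A. real (d2 n)) \<le> 12 * C\<^sub>I * real (card A) * ln X powr (5 / 2)"
proof -
  define D where "D = nat \<lfloor>sqrt (2 * X)\<rfloor>"
  have "1 \<le> sqrt (2 * X)" using X_ge by simp
  hence D_bounds: "1 \<le> D" "real D \<le> sqrt (2 * X)" "sqrt (2 * X) < real (Suc D)"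
    unfolding D_def by linarith+
  have A_range: "0 < n \<and> n < Suc D * Suc D" if "n \<in> A" for n
  proof -
    have n_range: "X < real n" "real n \<le> X + H"
      using that by (auto simp: A_def mem_missing_digit_interval_iff)
    have "real n < sqrt (2 * X) * sqrt (2 * X)" using n_range H_less_X X_ge by simp
    also have "\<dots> \<le> real (Suc D) * real (Suc D)" using D_bounds X_ge by (intro mult_mono) auto
    finally have "n < Suc D * Suc D" by (simp only: of_nat_mult [symmetric] of_nat_less_iff)
    thus ?thesis using n_range X_ge by auto
  qed
  have "sqrt (2 * X) \<le> X"
    using X_ge by (intro real_le_lsqrt) (auto simp: power2_eq_square)
  hence "ln (real D) \<le> ln X" using D_bounds X_ge by (subst ln_le_cancel_iff) auto
  hence harm_D_le: "harm D \<le> 2 * ln X" using harm_le_ln[of D] D_bounds ln_X_ge by simp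
  have "sqrt 2 \<le> (2 :: real)" by (simp add: real_le_lsqrt)
  hence "sqrt (2 * X) \<le> 2 * sqrt X" using X_ge by (simp add: real_sqrt_mult mult_right_mono)
  hence D_le: "real D \<le> 2 * sqrt X" using D_bounds(2) by linarith
  have "(\<Sum>n\<in>A. real (d2 n)) \<le> 2 * (harm D * (\<Sum>q=1..D. fraction_mean A q 0))"
    using A_range by (intro sum_d2_le) (auto simp: A_def finite_missing_digit_interval)
  also have "\<dots> \<le> 2 * (2 * ln X * (3 * C\<^sub>I * real (card A) * ln X powr (3 / 2)))"
    using harm_D_le D_bounds(1) D_le ln_X_ge
    by (intro mult_left_mono mult_mono sum_fraction_mean_A_le_of_le_sqrt)
       (auto intro: sum_nonneg fraction_mean_nonneg)
  also have "\<dots> = 12 * C\<^sub>I * real (card A) * (ln X * ln X powr (3 / 2))"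
    by simp
  also have "ln X * ln X powr (3 / 2) = ln X powr (5 / 2)"
    using ln_X_ge powr_mult_base[of "ln X" "3 / 2"] by simp
  finally show ?thesis .
qed

lemma mult_L_power_le_card_A:
  assumes "P * ln X powr (3 / 2) \<le> sqrt X"
  shows "P * L ^ j \<le> real (card A)"
proof -
  have "P * ln X powr (3 / 2) * L ^ j \<le> sqrt X * L ^ j"
    using assms L_ge by (intro mult_right_mono) auto
  hence "(P * L ^ j) * ln X powr (3 / 2) \<le> real (card A) * ln X powr (3 / 2)"
    using sqrt_X_mult_L_power_le by (simp add: mult_ac)
  thus ?thesis using ln_X_ge by simp
qed

lemma norm_major_arc_term_A_le:
  assumes P: "4 * real g \<le> P" "P ^ 4 \<le> X" "P * ln X powr (3 / 2) \<le> sqrt X"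
  shows "norm (major_arc_term A X H P (P ^ 2)) \<le> 64 * C\<^sub>I * real (card A) * ln X powr (5 / 2)"
proof -
  define D where "D = nat \<lfloor>P\<rfloor>"
  have P_ge: "1 \<le> P" using P(1) g_ge by linarith
  hence D_bounds: "1 \<le> D" "real D \<le> P" unfolding D_def by linarith+
  have bounds: "3 \<le> X" "0 < H" "H \<le> X" "1 \<le> P ^ 2"
    using X_ge H_ge_1 H_less_X P_ge by auto
  obtain \<beta> where \<beta>: "\<And>q. \<bar>\<beta> q\<bar> \<le> 1 / (real q * P ^ 2)"
    and major_arc_le: "norm (major_arc_term A X H P (P ^ 2)) \<le>
      32 * ln X ^ 2 * (\<Sum>q=1..D. fraction_mean A q (\<beta> q))"
    using norm_major_arc_term_le[OF bounds(1-3) P_ge P(2) bounds(4)] unfolding D_def by blast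
  have "\<bar>\<beta> q\<bar> \<le> 1 / (4 * real g * real q ^ 2)" if "q \<in> {1..D}" for q
    using inverse_mult_square_le[of "4 * real g" P "real q"] P(1) g_ge \<beta>[of q]
      that D_bounds(2) by auto
  hence "(\<Sum>q=1..D. fraction_mean A q (\<beta> q)) \<le> C\<^sub>I * (real (card A) + real D * L ^ j)"
    by (rule sum_fraction_mean_A_le[OF D_bounds(1)])
  also have "real D * L ^ j \<le> P * L ^ j" using D_bounds L_ge by (intro mult_right_mono) auto
  hence "C\<^sub>I * (real (card A) + real D * L ^ j) \<le> C\<^sub>I * (2 * real (card A))"
    using C\<^sub>I_nonneg mult_L_power_le_card_A[OF P(3)] by (intro mult_left_mono) auto
  finally have "norm (major_arc_term A X H P (P ^ 2)) \<le> 32 * ln X ^ 2 * (C\<^sub>I * (2 * real (card A)))"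
    by (intro order.trans[OF major_arc_le] mult_left_mono) auto
  also have "\<dots> = 64 * C\<^sub>I * real (card A) * ln X powr 2"
    using ln_X_ge by (simp add: powr_numeral)
  also have "\<dots> \<le> 64 * C\<^sub>I * real (card A) * ln X powr (5 / 2)"
    using C\<^sub>I_nonneg ln_X_ge by (intro mult_left_mono powr_mono) auto
  finally show ?thesis .
qed

lemma norm_sum_d2_diff_major_arc_term_le:
  assumes "4 * real g \<le> P" "P ^ 4 \<le> X" "P * ln X powr (3 / 2) \<le> sqrt X"
  shows "norm ((\<Sum>n\<in>A. of_nat (d2 n)) - major_arc_term A X H P (P ^ 2)) \<le>
    76 * C\<^sub>I * real (card A) * ln X powr (5 / 2)"
proof -
  have "norm (\<Sum>n\<in>A. complex_of_nat (d2 n)) \<le> (\<Sum>n\<in>A. real (d2 n))"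
    by (rule order.trans[OF norm_sum]) simp
  thus ?thesis
    using sum_d2_A_le norm_major_arc_term_A_le[OF assms]
      norm_triangle_ineq4[of "\<Sum>n\<in>A. complex_of_nat (d2 n)" "major_arc_term A X H P (P ^ 2)"]
    by linarith
qed

end

context large_base
begin

lemma short_interval_if_card_near:
  assumes b: "b \<noteq> 1" and size: "1 \<le> prescribed_size (real g ^ k)"
      "prescribed_size (real g ^ k) + 2 \<le> (real g - 1) ^ k"
    and near: "\<bar>real (card (missing_digit_interval g b 1 H)) - prescribed_size (real g ^ k)\<bar> < 1"
  obtains j where "short_interval g b k j H"
proof -
  have "missing_digit_interval g b 1 H \<noteq> {}" using size(1) near by auto
  hence H_ge_1: "1 \<le> H" by (auto simp: mem_missing_digit_interval_iff)
  hence "1 \<le> nat \<lfloor>H\<rfloor>" by linarith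
  then obtain j where j_bounds: "g ^ j \<le> nat \<lfloor>H\<rfloor>" "nat \<lfloor>H\<rfloor> < g ^ Suc j"
    using ex_power_ivl1[OF g_ge_2] by auto
  have H_ge: "real g ^ j \<le> H" and H_less: "H < real g ^ Suc j"
    using of_nat_mono[OF j_bounds(1), where 'a = real]
      of_nat_mono[OF Suc_leI[OF j_bounds(2)], where 'a = real] H_ge_1
    unfolding of_nat_power by linarith+
  have "card (missing_digit_interval g b 0 H) = Suc (card (missing_digit_interval g b 1 H))"
    unfolding missing_digit_interval_0_eq_insert[OF b H_ge_1]
    by (intro card_insert_disjoint)
       (auto simp: finite_missing_digit_interval mem_missing_digit_interval_iff)
  hence card_bounds: "prescribed_size (real g ^ k) < real (card (missing_digit_interval g b 0 H))"
    "real (card (missing_digit_interval g b 0 H)) < prescribed_size (real g ^ k) + 2"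
    using near by linarith+
  have "real ((g - 1) ^ j) < (real g - 1) ^ k"
    using of_nat_mono[OF power_le_card_missing_digit_interval[OF b H_ge], where 'a = real]
      card_bounds size(2)
    by linarith
  hence "(real g - 1) ^ j < (real g - 1) ^ k" using g_ge by (simp add: of_nat_diff)
  hence "j < k" using g_ge by (simp add: power_strict_increasing_iff)
  hence "short_interval g b k j H"
    using b H_ge H_less card_bounds(1) by unfold_locales auto
  thus ?thesis by (rule that)
qed

lemma error_bound:
  assumes b: "b \<noteq> 1" and X: "X = real g ^ k" and A: "A = missing_digit_interval g b X (X + H)"
    and size: "1 \<le> prescribed_size X" "prescribed_size X + 2 \<le> (real g - 1) ^ k"
    and near: "\<bar>real (card (missing_digit_interval g b 1 H)) - prescribed_size X\<bar> < 1"
    and P: "4 * real g \<le> P" "P ^ 4 \<le> X" "P * ln X powr (3 / 2) \<le> sqrt X"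
  shows "norm ((\<Sum>n\<in>A. of_nat (d2 n)) - major_arc_term A X H P (P ^ 2)) \<le>
    76 * C\<^sub>I * real (card A) * ln X powr (5 / 2)"
proof -
  obtain j where "short_interval g b k j H"
    using short_interval_if_card_near[OF b] size near unfolding X by blast
  then interpret I: short_interval g b k j H .
  show ?thesis
    using I.norm_sum_d2_diff_major_arc_term_le[of P] P by (simp only: A X I.A_def I.X_def)
qed

lemma powr_three_quarters_less: "real g powr (3 / 4) < real g - 1"
proof -
  have "3 \<le> exp (2 :: real)" using exp_ge_add_one_self[of "2 :: real"] by simp
  also have "\<dots> \<le> exp (1 / 4 * ln (real g))" using ln_base_ge by simp
  also have "\<dots> = real g powr (1 / 4)" using g_ge by (simp add: powr_def)
  finally have "3 * real g powr (3 / 4) \<le> real g powr (1 / 4) * real g powr (3 / 4)"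
    by (intro mult_right_mono) auto
  also have "\<dots> = real g" using g_ge by (simp flip: powr_add)
  finally show ?thesis using g_ge by simp
qed

lemma power_at_top: "filterlim (\<lambda>k. real g ^ k) at_top sequentially"
  using g_ge by real_asymp

lemma eventually_prescribed_size_ge_1:
  "\<forall>\<^sub>F k in sequentially. 1 \<le> prescribed_size (real g ^ k)"
proof (rule eventually_compose_filterlim[OF _ power_at_top])
  have "0 < 1 / (2 * lambda_exp g)" using lambda_ge by simp
  thus "\<forall>\<^sub>F X in at_top. 1 \<le> prescribed_size X"
    unfolding prescribed_size_def by real_asymp
qed

lemma prescribed_size_le_powr:
  assumes "1 \<le> X" "1 \<le> ln X"
  shows "prescribed_size X \<le> X powr (3 / 4)"
proof -
  have "prescribed_size X \<le> X powr (1 / (2 * lambda_exp g))"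
    unfolding prescribed_size_def using assms lambda_ge
    by (intro powr_mono2) (auto simp: divide_le_eq mult_le_cancel_left1)
  also have "\<dots> \<le> X powr (3 / 4)"
    using assms lambda_ge by (intro powr_mono) (auto simp: field_simps)
  finally show ?thesis .
qed

lemma eventually_prescribed_size_less_power:
  "\<forall>\<^sub>F k in sequentially. prescribed_size (real g ^ k) + 2 \<le> (real g - 1) ^ k"
proof -
  define c d where "c = real g powr (3 / 4)" and "d = real g - 1"
  have "1 < c" "c < d"
    using g_ge powr_three_quarters_less by (auto simp: c_def d_def)
  hence "\<forall>\<^sub>F k in sequentially. c ^ k + 2 \<le> d ^ k" by real_asymp
  moreover have "\<forall>\<^sub>F X in at_top. (1::real) \<le> ln X" by real_asymp
  hence "\<forall>\<^sub>F k in sequentially. 1 \<le> ln (real g ^ k)"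
    by (rule eventually_compose_filterlim[OF _ power_at_top])
  ultimately show ?thesis
  proof eventually_elim
    case (elim k)
    have "prescribed_size (real g ^ k) \<le> (real g ^ k) powr (3 / 4)"
      using elim(2) g_ge by (intro prescribed_size_le_powr) auto
    also have "\<dots> = c ^ k"
      using g_ge by (simp add: c_def powr_power powr_powr mult.commute flip: powr_realpow)
    finally show ?case using elim(1) by (simp add: d_def)
  qed
qed

lemma eventually_major_arc_bounds:
  assumes "0 < \<eta>" "\<eta> < 1 / 4"
  shows "\<forall>\<^sub>F k in sequentially. let X = real g ^ k; P = X powr (1 / 4 - \<eta>) in
    4 * real g \<le> P \<and> P ^ 4 \<le> X \<and> P * ln X powr (3 / 2) \<le> sqrt X"
  unfolding Let_def
proof (rule eventually_compose_filterlim[OF _ power_at_top], intro eventually_conj)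
  show "\<forall>\<^sub>F X in at_top. 4 * real g \<le> X powr (1 / 4 - \<eta>)"
    and "\<forall>\<^sub>F X in at_top. (X powr (1 / 4 - \<eta>)) ^ 4 \<le> X"
    and "\<forall>\<^sub>F X in at_top. X powr (1 / 4 - \<eta>) * ln X powr (3 / 2) \<le> sqrt X"
    using assms by real_asymp+
qed

end

lemma eventually_large_base:
  "\<forall>\<^sub>F g in sequentially. \<forall>b. 0 < b \<and> b < g \<longrightarrow> large_base g b"
proof -
  have "\<forall>\<^sub>F g in sequentially. 8 \<le> ln (real g)" by real_asymp
  moreover have "\<forall>\<^sub>F g in sequentially. 2 * (real g * (ln (real g) + 1) / (real g - 1)) ^ 2 \<le> real g"
    by real_asymp
  moreover have "\<forall>\<^sub>F g in sequentially. 2 / 3 \<le> lambda_exp g"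
    unfolding lambda_exp_def by real_asymp
  ultimately show ?thesis
    by eventually_elim (simp add: large_base_def large_base_axioms_def missing_digit_def)
qed

theorem theorem1p1:
  shows "\<exists>(g\<^sub>0::nat) (\<eta>\<^sub>0::real). \<eta>\<^sub>0 > 0 \<and>
    (\<forall>g\<ge>g\<^sub>0. \<forall>b\<in>{2..g - 1}. \<forall>\<eta>. 0 < \<eta> \<and> \<eta> < \<eta>\<^sub>0 \<longrightarrow>
      (\<exists>C::real. \<forall>\<^sub>F k::nat in at_top. \<forall>H::real.
        let X = real g ^ k;
            P = X powr (1 / 4 - \<eta>);
            Q = P ^ 2;
            A = missing_digit_interval g b X (X + H)
        in H > 0 \<and>
           \<bar>real (card (missing_digit_interval g b 1 H))
             - (X / (ln X) ^ 3) powr (1 / (2 * lambda_exp g))\<bar> < 1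
           \<longrightarrow> norm ((\<Sum>n\<in>A. of_nat (d2 n)) - major_arc_term A X H P Q)
                 \<le> C * real (card A) * (ln X) powr (5 / 2)))"
proof -
  obtain g\<^sub>0 where g\<^sub>0: "\<And>g b. g\<^sub>0 \<le> g \<Longrightarrow> 0 < b \<Longrightarrow> b < g \<Longrightarrow> large_base g b"
    using eventually_large_base by (auto simp: eventually_sequentially)
  show ?thesis
  proof (rule exI[of _ g\<^sub>0], rule exI[of _ "1 / 4"], intro conjI allI ballI impI, goal_cases)
    case (2 g b \<eta>)
    then interpret large_base g b by (intro g\<^sub>0) auto
    have b: "b \<noteq> 1" and \<eta>: "0 < \<eta>" "\<eta> < 1 / 4" using 2 by auto
    show ?case
      using eventually_prescribed_size_ge_1 eventually_prescribed_size_less_power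
        eventually_major_arc_bounds[OF \<eta>]
      by (intro exI[of _ "76 * C\<^sub>I"], eventually_elim)
         (auto simp: Let_def prescribed_size_def [symmetric] intro!: error_bound[OF b refl refl])
  qed simp
qed

end
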